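(* Let $\mathcal X$ and $\mathcal Z$ be finite-dimensional, $E\in\mathcal L(\mathcal X,\mathcal Z)$ and $A\colon\mathcal X\to\mathcal Z$ linear with $\rho(E,A)\neq\emptyset$. Then $$p_{\rm nilp}^{(E,A)}=p_{\rm rad}^{(E,A)}+1=p_{\rm res}^{(E,A)}.$$
   Context: $\rho(E,A)$ is the set of $\lambda\in\mathbb C$ for which $\lambda E-A$ is invertible. Resolvent index $p_{\rm res}^{(E,A)}$: the smallest $p\in\mathbb N_0$ such that there are $\omega\in\mathbb R$, $C>0$ with $(\omega,\infty)\subseteq\rho(E,A)$ and $\|(\lambda E-A)^{-1}\|\le C|\lambda|^{p-1}$ for all $\lambda\in(\omega,\infty)$. Radiality index $p_{\rm rad}^{(E,A)}$: the smallest $p\in\mathbb N_0$ such that there are $\omega\in\mathbb R$, $C>0$ with $(\omega,\infty)\subseteq\rho(E,A)$ and, for all $\lambda_0,\dots,\lambda_p>\omega$, both $\|(\lambda_0E-A)^{-1}E\cdots(\lambda_pE-A)^{-1}E\|$ and $\|E(\lambda_0E-A)^{-1}\cdots E(\lambda_pE-A)^{-1}\|$ are at most $C\prod_{k=0}^p\frac1{|\lambda_k-\omega|}$. Nilpotency index $p_{\rm nilp}^{(E,A)}$: two pairs are equivalent, $(E,A)\sim(\tilde E,\tilde A)$, if there are isomorphisms $P,Q$ with $E=Q^{-1}\tilde EP$, $A=Q^{-1}\tilde AP$. A Weierstraß form of $(E,A)$ is an equivalent pair $\left(\begin{bmatrix}I_{\mathcal Y^1}&0\\0&N\end{bmatrix},\begin{bmatrix}A_1&0\\0&I_{\mathcal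 Y^2}\end{bmatrix}\right)$ on a Hilbert space $\mathcal Y^1\oplus\mathcal Y^2$ with $N\colon\mathcal Y^2\to\mathcal Y^2$ bounded and nilpotent; in finite dimensions it exists whenever $\rho(E,A)\ne\emptyset$. The nilpotency index is the degree of nilpotency of $N$ (the $p$ with $N^p=0$ and $N^l\neq0$ for $l<p$), and $0$ if $N$ is absent (i.e. $(E,A)\sim(I_{\mathcal Y^1},A_1)$).
   Formalization: The equalities with p_rad+1 are claimed only for non-invertible E (N present); for invertible E only p_nilp = p_res is claimed, since then p_nilp = p_res = 0 while p_rad+1 ≥ 1 (e.g. E = 1, A = 0 on ℂ). *)

theory Defs
  imports "HOL-Analysis.Analysis"
begin

section \<open>Complex Hilbert spaces\<close>

class complex_vector = real_vector +
  fixes scaleC :: "complex \<Rightarrow> 'a \<Rightarrow> 'a" (infixr \<open>*\<^sub>C\<close> 75)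
  assumes scaleC_add_right: "a *\<^sub>C (x + y) = a *\<^sub>C x + a *\<^sub>C y"
    and scaleC_add_left: "(a + b) *\<^sub>C x = a *\<^sub>C x + b *\<^sub>C x"
    and scaleC_scaleC: "a *\<^sub>C (b *\<^sub>C x) = (a * b) *\<^sub>C x"
    and scaleC_one: "1 *\<^sub>C x = x"
    and scaleR_scaleC: "r *\<^sub>R x = complex_of_real r *\<^sub>C x"

global_interpretation complex_vector:
  vector_space "scaleC :: complex \<Rightarrow> 'a \<Rightarrow> 'a :: complex_vector"
  defines csubspace = complex_vector.subspace
    and cspan = complex_vector.span
  by unfold_locales (simp_all add: scaleC_add_right scaleC_add_left scaleC_scaleC scaleC_one)

abbreviation clinear :: "('a::complex_vector \<Rightarrow> 'b::complex_vector) \<Rightarrow> bool" where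
  "clinear \<equiv> Vector_Spaces.linear scaleC scaleC"

(* Positive definiteness of the inner product is contained in the last axiom together with the
   norm axioms: norm x >= 0 forces Re (cinner x x) >= 0, and norm x = 0 only for x = 0.
   The one-point space is allowed as an instance. *)
class complex_hilbert = complex_vector + banach +
  fixes cinner :: "'a \<Rightarrow> 'a \<Rightarrow> complex"
  assumes cinner_commute: "cinner x y = cnj (cinner y x)"
    and cinner_add_left: "cinner (x + y) z = cinner x z + cinner y z"
    and cinner_scaleC_left: "cinner (a *\<^sub>C x) y = a * cinner x y"
    and norm_eq_sqrt_cinner: "norm x = sqrt (Re (cinner x x))"

instantiation complex :: complex_hilbert
begin
definition "scaleC_complex (a::complex) (x::complex) = a * x"
definition "cinner_complex (x::complex) y = x * cnj y"
instance
  by standard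
    (simp_all add: scaleC_complex_def cinner_complex_def algebra_simps scaleR_conv_of_real
      cmod_def power2_eq_square)
end

instantiation prod :: (complex_vector, complex_vector) complex_vector
begin
definition "scaleC_prod a x = (a *\<^sub>C fst x, a *\<^sub>C snd x)"
instance
  by standard
    (auto simp: scaleC_prod_def scaleC_add_right scaleC_add_left scaleC_scaleC scaleC_one
      scaleR_scaleC prod_eq_iff)
end

lemma Re_cinner_self: "Re (cinner x x) = (norm (x::'a::complex_hilbert))\<^sup>2"
proof -
  have "0 \<le> sqrt (Re (cinner x x))"
    unfolding norm_eq_sqrt_cinner[symmetric] by simp
  then show ?thesis by (simp add: norm_eq_sqrt_cinner)
qed

instantiation prod :: (complex_hilbert, complex_hilbert) complex_hilbert
begin
definition "cinner_prod x y = cinner (fst x) (fst y) + cinner (snd x) (snd y)"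
instance
proof
  fix x y z :: "'a \<times> 'b" and a :: complex
  show "cinner x y = cnj (cinner y x)"
    unfolding cinner_prod_def
    by (subst (1 2) cinner_commute) simp
  show "cinner (x + y) z = cinner x z + cinner y z"
    by (simp add: cinner_prod_def cinner_add_left)
  show "cinner (a *\<^sub>C x) y = a * cinner x y"
    by (simp add: cinner_prod_def scaleC_prod_def cinner_scaleC_left distrib_left)
  show "norm x = sqrt (Re (cinner x x))"
    by (simp add: cinner_prod_def norm_prod_def Re_cinner_self)
qed
end

definition finite_dim :: "'a::complex_vector itself \<Rightarrow> bool" where
  "finite_dim _ \<longleftrightarrow> (\<exists>B :: 'a set. finite B \<and> cspan B = UNIV)"

definition bounded_clinear :: "('a::complex_hilbert \<Rightarrow> 'b::complex_hilbert) \<Rightarrow> bool" where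
  "bounded_clinear f \<longleftrightarrow> clinear f \<and> bounded_linear f"


section \<open>Resolvent set, resolvent index and radiality index\<close>

(* The definitions in this and the next section are meant for linear maps between
   finite-dimensional spaces: inverses, isomorphisms and subspaces carry no boundedness or
   closedness requirements. *)

definition pencil ::
  "('x::complex_hilbert \<Rightarrow> 'z::complex_hilbert) \<Rightarrow> ('x \<Rightarrow> 'z) \<Rightarrow> complex \<Rightarrow> 'x \<Rightarrow> 'z" where
  "pencil E A \<mu> x = \<mu> *\<^sub>C E x - A x"

definition resolvent_set ::
  "('x::complex_hilbert \<Rightarrow> 'z::complex_hilbert) \<Rightarrow> ('x \<Rightarrow> 'z) \<Rightarrow> complex set" where
  "resolvent_set E A = {\<mu>. bij (pencil E A \<mu>)}"

definition resolvent ::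
  "('x::complex_hilbert \<Rightarrow> 'z::complex_hilbert) \<Rightarrow> ('x \<Rightarrow> 'z) \<Rightarrow> real \<Rightarrow> 'z \<Rightarrow> 'x" where
  "resolvent E A \<mu> = inv (pencil E A (complex_of_real \<mu>))"

definition res_index ::
  "('x::complex_hilbert \<Rightarrow> 'z::complex_hilbert) \<Rightarrow> ('x \<Rightarrow> 'z) \<Rightarrow> nat" where
  "res_index E A = (LEAST p. \<exists>\<omega>::real. \<exists>C>0.
     complex_of_real ` {\<omega><..} \<subseteq> resolvent_set E A \<and>
     (\<forall>\<mu>>\<omega>. onorm (resolvent E A \<mu>) \<le> C * \<bar>\<mu>\<bar> powi (int p - 1)))"

(* comp_upto F p = F 0 o F 1 o ... o F p *)
definition comp_upto :: "(nat \<Rightarrow> 'a \<Rightarrow> 'a) \<Rightarrow> nat \<Rightarrow> 'a \<Rightarrow> 'a" where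
  "comp_upto F p = foldr (\<circ>) (map F [0..<Suc p]) id"

definition rad_index ::
  "('x::complex_hilbert \<Rightarrow> 'z::complex_hilbert) \<Rightarrow> ('x \<Rightarrow> 'z) \<Rightarrow> nat" where
  "rad_index E A = (LEAST p. \<exists>\<omega>::real. \<exists>C>0.
     complex_of_real ` {\<omega><..} \<subseteq> resolvent_set E A \<and>
     (\<forall>\<mu> :: nat \<Rightarrow> real. (\<forall>k\<le>p. \<mu> k > \<omega>) \<longrightarrow>
        onorm (comp_upto (\<lambda>k. resolvent E A (\<mu> k) \<circ> E) p) \<le> C * (\<Prod>k\<le>p. 1 / \<bar>\<mu> k - \<omega>\<bar>) \<and>
        onorm (comp_upto (\<lambda>k. E \<circ> resolvent E A (\<mu> k)) p) \<le> C * (\<Prod>k\<le>p. 1 / \<bar>\<mu> k - \<omega>\<bar>)))"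


section \<open>Weierstrass form and nilpotency index\<close>

definition linear_endo_on :: "'a::complex_vector set \<Rightarrow> ('a \<Rightarrow> 'a) \<Rightarrow> bool" where
  "linear_endo_on Y f \<longleftrightarrow> (\<forall>x\<in>Y. f x \<in> Y) \<and>
     (\<forall>x\<in>Y. \<forall>y\<in>Y. f (x + y) = f x + f y) \<and> (\<forall>c. \<forall>x\<in>Y. f (c *\<^sub>C x) = c *\<^sub>C f x)"

definition bounded_on :: "'a::real_normed_vector set \<Rightarrow> ('a \<Rightarrow> 'a) \<Rightarrow> bool" where
  "bounded_on Y f \<longleftrightarrow> (\<exists>K. \<forall>x\<in>Y. norm (f x) \<le> K * norm x)"

(* Equivalence of the pair (E, A) with a pair (E', A') of maps from the subspace Y to the
   subspace W. *)
definition equivalent_pairs ::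
  "('x::complex_vector \<Rightarrow> 'z::complex_vector) \<Rightarrow> ('x \<Rightarrow> 'z) \<Rightarrow>
   'y::complex_vector set \<Rightarrow> 'w::complex_vector set \<Rightarrow> ('y \<Rightarrow> 'w) \<Rightarrow> ('y \<Rightarrow> 'w) \<Rightarrow> bool" where
  "equivalent_pairs E A Y W E' A' \<longleftrightarrow>
     (\<exists>P Q. clinear P \<and> bij_betw P UNIV Y \<and> clinear Q \<and> bij_betw Q UNIV W \<and>
        E = inv Q \<circ> E' \<circ> P \<and> A = inv Q \<circ> A' \<circ> P)"

(* HOL cannot quantify over the types of the spaces Y1 and Y2.  Both are taken as subspaces of 'x,
   and Y1 (+) Y2 as the external orthogonal sum Y1 \<times> Y2 inside 'x \<times> 'x.  This is no restriction:
   if Y1 (+) Y2 is isomorphic to the finite-dimensional space 'x, then Y1 and Y2 have dimension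
   at most that of 'x and are isometrically isomorphic to subspaces of 'x.
   The case that N is absent is Y2 = {0}. *)
definition weierstrass_form ::
  "('x::complex_hilbert \<Rightarrow> 'z::complex_hilbert) \<Rightarrow> ('x \<Rightarrow> 'z) \<Rightarrow>
   'x set \<Rightarrow> 'x set \<Rightarrow> ('x \<Rightarrow> 'x) \<Rightarrow> ('x \<Rightarrow> 'x) \<Rightarrow> bool" where
  "weierstrass_form E A Y1 Y2 A1 N \<longleftrightarrow>
     csubspace Y1 \<and> csubspace Y2 \<and> linear_endo_on Y1 A1 \<and>
     linear_endo_on Y2 N \<and> bounded_on Y2 N \<and> (\<exists>p. \<forall>y\<in>Y2. (N ^^ p) y = 0) \<and>
     equivalent_pairs E A (Y1 \<times> Y2) (Y1 \<times> Y2)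
       (\<lambda>(u, v). (u, N v)) (\<lambda>(u, v). (A1 u, v))"

(* On Y = {0} already N ^^ 0 vanishes, so the degree is 0, as required when N is absent. *)
definition nilpotency_degree :: "'a::zero set \<Rightarrow> ('a \<Rightarrow> 'a) \<Rightarrow> nat" where
  "nilpotency_degree Y N = (LEAST p. \<forall>y\<in>Y. (N ^^ p) y = 0)"

definition nilp_index ::
  "('x::complex_hilbert \<Rightarrow> 'z::complex_hilbert) \<Rightarrow> ('x \<Rightarrow> 'z) \<Rightarrow> nat" where
  "nilp_index E A = (THE p. \<exists>Y1 Y2 A1 N.
     weierstrass_form E A Y1 Y2 A1 N \<and> p = nilpotency_degree Y2 N)"

end

theory Submission
  imports Defs
begin

text \<open>
  Put a Weierstrass form on \<open>(E, A)\<close> and let \<open>d\<close> be the degree of nilpotency of \<open>N\<close>.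
  For large real \<open>\<nu>\<close> the resolvent is equivalent to the pair of \<open>(\<nu> - A\<^sub>1)\<^sup>-\<^sup>1 = O(1 / \<nu>)\<close> and
  \<open>(\<nu> N - 1)\<^sup>-\<^sup>1 = - (\<Sum>k<d. \<nu>\<^sup>k N\<^sup>k)\<close>, which grows exactly like \<open>\<nu>\<close> to the power \<open>d - 1\<close>; so the
  resolvent index is \<open>d\<close>. A product of \<open>p + 1\<close> factors \<open>N (\<nu>\<^sub>k N - 1)\<^sup>-\<^sup>1\<close> vanishes if \<open>p + 1 \<ge> d\<close>;
  otherwise it acts as \<open>\<plusminus> N\<close> to the power \<open>p + 1\<close> on the vectors killed by the next power of \<open>N\<close>, and
  does not decay. Hence the radiality index is \<open>d - 1\<close> if \<open>d > 0\<close>. As this holds for every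
  Weierstrass form, \<open>d\<close> does not depend on its choice. A Weierstrass form is obtained from the
  Fitting decomposition of \<open>(\<mu> E - A)\<^sup>-\<^sup>1 E\<close> for one \<open>\<mu>\<close> in the resolvent set.
\<close>

section \<open>Complex-linear maps and their inverses\<close>

lemma clinearI:
  fixes f :: "'a::complex_vector \<Rightarrow> 'b::complex_vector"
  assumes "\<And>x y. f (x + y) = f x + f y" and "\<And>c x. f (c *\<^sub>C x) = c *\<^sub>C f x"
  shows "clinear f"
  by unfold_locales (simp_all add: assms)

lemma clinear_add: "clinear f \<Longrightarrow> f (x + y) = f x + f y"
  and clinear_scaleC: "clinear f \<Longrightarrow> f (c *\<^sub>C x) = c *\<^sub>C f x"
  by (auto simp: Vector_Spaces.linear_iff)

lemma clinear_diff: "clinear f \<Longrightarrow> f (x - y) = f x - f y"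
  by (metis clinear_add diff_add_cancel eq_diff_eq)

lemma clinear_0: "clinear f \<Longrightarrow> f 0 = 0"
  using clinear_diff[of f 0 0] by simp

lemma clinear_sum: "clinear f \<Longrightarrow> f (sum g S) = (\<Sum>i\<in>S. f (g i))"
  by (induction S rule: infinite_finite_induct) (auto simp: clinear_0 clinear_add)

lemma clinear_compose: "clinear f \<Longrightarrow> clinear g \<Longrightarrow> clinear (f \<circ> g)"
  by (intro clinearI) (simp_all add: clinear_add clinear_scaleC)

lemma clinear_inv:
  assumes "clinear f" "bij f"
  shows "clinear (inv f)"
proof (rule clinearI)
  show "inv f (x + y) = inv f x + inv f y" for x y
    using assms by (intro inv_f_eq) (auto simp: bij_def clinear_add surj_f_inv_f)
  show "inv f (c *\<^sub>C x) = c *\<^sub>C inv f x" for c x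
    using assms by (intro inv_f_eq) (auto simp: bij_def clinear_scaleC surj_f_inv_f)
qed

lemma scaleC_diff_right: "c *\<^sub>C (x - y) = c *\<^sub>C x - c *\<^sub>C y"
  and scaleC_zero_right: "c *\<^sub>C 0 = (0 :: 'a)"
  for x y :: "'a::complex_vector"
  by (simp_all add: complex_vector.scale_right_diff_distrib)

section \<open>Inner products, orthonormal systems and boundedness in finite dimension\<close>

lemma norm_scaleC: "norm (c *\<^sub>C (x :: 'a::complex_hilbert)) = cmod c * norm x"
proof -
  have "cinner (c *\<^sub>C x) (c *\<^sub>C x) = (c * cnj c) * cinner x x"
    by (subst cinner_scaleC_left, subst cinner_commute, subst cinner_scaleC_left)
      (metis cinner_commute complex_cnj_mult mult.assoc)
  then have "Re (cinner (c *\<^sub>C x) (c *\<^sub>C x)) = (cmod c)\<^sup>2 * Re (cinner x x)"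
    by (simp add: complex_mult_cnj cmod_def)
  then have "(norm (c *\<^sub>C x))\<^sup>2 = (cmod c * norm x)\<^sup>2"
    by (simp add: Re_cinner_self power_mult_distrib)
  then show ?thesis by (simp add: power2_eq_iff_nonneg)
qed

lemma cinner_sum_left: "cinner (\<Sum>i\<in>S. f i) y = (\<Sum>i\<in>S. cinner (f i) y)"
proof -
  have "cinner 0 y = 0" by (metis add_cancel_right_right add_0 cinner_add_left)
  then show ?thesis by (induction S rule: infinite_finite_induct) (auto simp: cinner_add_left)
qed

text \<open>Pythagoras: the residual \<open>r\<close> of the projection of \<open>x\<close> onto
  \<open>e\<close> is orthogonal to \<open>e\<close>, so the squared norms of the two parts add up
  to that of \<open>x\<close>.\<close>

lemma norm_cinner_le:
  fixes x e :: "'a::complex_hilbert"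
  assumes "cinner e e = 1"
  shows "cmod (cinner x e) \<le> norm x"
proof -
  define c r where "c = cinner x e" and "r = x - c *\<^sub>C e"
  have re: "cinner r e = 0"
  proof -
    have "cinner x e = cinner (c *\<^sub>C e + r) e" by (simp add: r_def)
    then show ?thesis using assms by (simp add: cinner_add_left cinner_scaleC_left c_def)
  qed
  have "cinner x x = c * cinner e (c *\<^sub>C e + r) + cinner r (c *\<^sub>C e + r)"
    unfolding r_def by (metis add.commute diff_add_cancel cinner_add_left cinner_scaleC_left)
  also have "cinner e (c *\<^sub>C e + r) = cnj c"
    by (subst cinner_commute) (simp add: cinner_add_left cinner_scaleC_left assms re)
  also have "cinner r (c *\<^sub>C e + r) = cinner r r"
    by (subst (1 2) cinner_commute, subst cinner_add_left, subst cinner_scaleC_left,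
        subst cinner_commute) (simp add: re)
  finally have "(norm x)\<^sup>2 = (cmod c)\<^sup>2 + (norm r)\<^sup>2"
    by (metis Re_cinner_self Re_complex_of_real complex_norm_square plus_complex.sel(1))
  then have "(cmod c)\<^sup>2 \<le> (norm x)\<^sup>2" by simp
  then show ?thesis by (simp add: c_def power2_le_iff_abs_le)
qed

text \<open>Gram-Schmidt: each new vector \<open>b\<close> is replaced by its normalised residual
  \<open>r\<close>, unless \<open>r\<close> vanishes and \<open>b\<close> is already in the
  span.\<close>

lemma orthonormal_spanning:
  fixes B :: "'a::complex_hilbert set"
  assumes "finite B"
  shows "\<exists>S. finite S \<and> (\<forall>e\<in>S. \<forall>f\<in>S. cinner e f = (if e = f then 1 else 0)) \<and>
    cspan B \<subseteq> cspan S"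
  using assms
proof (induction B rule: finite_induct)
  case empty
  show ?case by (intro exI[of _ "{}"]) auto
next
  case (insert b B)
  then obtain S where S: "finite S"
    "\<And>e f. e \<in> S \<Longrightarrow> f \<in> S \<Longrightarrow> cinner e f = (if e = f then 1 else 0)" "cspan B \<subseteq> cspan S"
    by blast
  define s where "s = (\<Sum>e\<in>S. cinner b e *\<^sub>C e)"
  define r where "r = b - s"
  have s: "s \<in> cspan S"
    unfolding s_def
    by (intro complex_vector.span_sum complex_vector.span_scale complex_vector.span_base)
  have orth: "cinner r f = 0" if "f \<in> S" for f
  proof -
    have "cinner s f = (\<Sum>e\<in>S. cinner b e * (if e = f then 1 else 0))"
      unfolding s_def cinner_sum_left using S(2) that by (simp add: cinner_scaleC_left)
    also have "\<dots> = cinner b f" using S(1) that by (simp add: if_distrib cong: if_cong)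
    finally show ?thesis using cinner_add_left[of r s f] by (simp add: r_def)
  qed
  show ?case
  proof (cases "r = 0")
    case True
    then have "b \<in> cspan S" using s by (simp add: r_def)
    then have "insert b B \<subseteq> cspan S"
      using S(3) complex_vector.span_superset[of B] by auto
    then have "cspan (insert b B) \<subseteq> cspan S"
      by (rule complex_vector.span_minimal[OF _ complex_vector.subspace_span])
    then show ?thesis using S by (intro exI[of _ S]) auto
  next
    case False
    define e where "e = complex_of_real (1 / norm r) *\<^sub>C r"
    have e1: "cinner e e = 1"
    proof -
      have "cinner e e = cnj (cinner e e)" by (rule cinner_commute)
      then have "Im (cinner e e) = 0" by (metis complex_cnj_cancel_iff complex_is_Real_iff Reals_cnj_iff)
      moreover have "norm e = 1" using False by (simp add: e_def norm_scaleC norm_divide)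
      ultimately show ?thesis using Re_cinner_self[of e] by (simp add: complex_eq_iff)
    qed
    have e0: "cinner e f = 0" "cinner f e = 0" if "f \<in> S" for f
    proof -
      show "cinner e f = 0" using orth[OF that] by (simp add: e_def cinner_scaleC_left)
      then show "cinner f e = 0" by (subst cinner_commute) simp
    qed
    have "b = complex_of_real (norm r) *\<^sub>C e + s"
      using False by (simp add: e_def r_def scaleC_scaleC scaleC_one flip: of_real_mult)
    moreover have "s \<in> cspan (insert e S)"
      using s complex_vector.span_mono[of S "insert e S"] by auto
    ultimately have "b \<in> cspan (insert e S)"
      by (simp add: complex_vector.span_add complex_vector.span_scale complex_vector.span_base)
    moreover have "B \<subseteq> cspan (insert e S)"
      using S(3) complex_vector.span_superset[of B] complex_vector.span_mono[of S "insert e S"]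
      by blast
    ultimately have "cspan (insert b B) \<subseteq> cspan (insert e S)"
      by (intro complex_vector.span_minimal[OF _ complex_vector.subspace_span]) auto
    moreover have "cinner f g = (if f = g then 1 else 0)"
      if "f \<in> insert e S" "g \<in> insert e S" for f g
      using that S(2) e0 e1 by auto
    ultimately show ?thesis using S(1) by (intro exI[of _ "insert e S"]) auto
  qed
qed

text \<open>In an orthonormal basis every coefficient of \<open>x\<close> is at most
  \<open>norm x\<close>, so the norms of the images of the basis vectors add up to a bound for
  \<open>f\<close>.\<close>

lemma clinear_bounded_linear:
  fixes f :: "'a::complex_hilbert \<Rightarrow> 'b::complex_hilbert"
  assumes "finite_dim TYPE('a)" and f: "clinear f"
  shows "bounded_linear f"
proof -
  obtain B :: "'a set" where "finite B" "cspan B = UNIV"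
    using assms(1) unfolding finite_dim_def by blast
  with orthonormal_spanning[of B] obtain S :: "'a set" where fin: "finite S"
    and on: "\<forall>e\<in>S. \<forall>f\<in>S. cinner e f = (if e = f then 1 else 0)" and sp: "cspan B \<subseteq> cspan S"
    by blast
  have S: "finite S" "cspan S = UNIV"
    "\<And>e f. e \<in> S \<Longrightarrow> f \<in> S \<Longrightarrow> cinner e f = (if e = f then 1 else 0)"
    using fin on sp \<open>cspan B = UNIV\<close> by auto
  have expand: "x = (\<Sum>e\<in>S. cinner x e *\<^sub>C e)" for x
  proof -
    have "x \<in> cspan S" using S by simp
    then obtain u where x: "x = (\<Sum>e\<in>S. u e *\<^sub>C e)"
      using complex_vector.span_finite[OF S(1)] by auto
    have "cinner x g = u g" if "g \<in> S" for g
    proof -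
      have "cinner x g = (\<Sum>e\<in>S. u e * (if e = g then 1 else 0))"
        unfolding x cinner_sum_left using S(3) that by (simp add: cinner_scaleC_left)
      also have "\<dots> = u g" using S(1) that by (simp add: if_distrib cong: if_cong)
      finally show ?thesis .
    qed
    then show ?thesis using x by simp
  qed
  show ?thesis
  proof (rule bounded_linear_intro)
    show "f (x + y) = f x + f y" for x y by (rule clinear_add[OF f])
    show "f (r *\<^sub>R x) = r *\<^sub>R f x" for r x by (simp add: scaleR_scaleC clinear_scaleC[OF f])
    show "norm (f x) \<le> norm x * (\<Sum>e\<in>S. norm (f e))" for x
    proof -
      have "f x = (\<Sum>e\<in>S. cinner x e *\<^sub>C f e)"
        using arg_cong[OF expand[of x], of f] by (simp only: clinear_sum[OF f] clinear_scaleC[OF f])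
      also have "norm \<dots> \<le> (\<Sum>e\<in>S. norm x * norm (f e))"
        using S(3) by (intro sum_norm_le) (simp add: norm_scaleC mult_right_mono norm_cinner_le)
      finally show ?thesis by (simp add: sum_distrib_left)
    qed
  qed
qed

section \<open>Dimension arguments\<close>

text \<open>Serves to bound the left inverses of the coordinate maps \<open>P\<close> and
  \<open>Q\<close>, which are defined on all of \<open>'x \<times> 'x\<close>.\<close>

lemma finite_dim_prod:
  assumes "finite_dim TYPE('a::complex_vector)" "finite_dim TYPE('b::complex_vector)"
  shows "finite_dim TYPE('a \<times> 'b)"
proof -
  obtain B :: "'a set" and C :: "'b set"
    where B: "finite B" "cspan B = UNIV" and C: "finite C" "cspan C = UNIV"
    using assms unfolding finite_dim_def by blast
  define D where "D = (\<lambda>b. (b, 0 :: 'b)) ` B \<union> (\<lambda>c. (0 :: 'a, c)) ` C"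
  have "(x, 0) \<in> cspan D" for x
  proof -
    \<comment> \<open>The vectors \<open>x\<close> with \<open>(x, 0)\<close> in the span form a
      subspace that contains \<open>B\<close>; the second factor is treated in the same way.\<close>
    have "cspan B \<subseteq> {x. (x, 0) \<in> cspan D}"
    proof (rule complex_vector.span_minimal)
      show "csubspace {x. (x, 0) \<in> cspan D}"
        unfolding complex_vector.subspace_def
      proof (intro conjI ballI allI)
        fix c and x y :: 'a
        assume "x \<in> {x. (x, 0) \<in> cspan D}"
        then have x: "(x, 0) \<in> cspan D" by simp
        then show "c *\<^sub>C x \<in> {x. (x, 0) \<in> cspan D}"
          using complex_vector.span_scale[OF x, of c]
          by (simp add: scaleC_prod_def scaleC_zero_right)
        assume "y \<in> {x. (x, 0) \<in> cspan D}"
        then show "x + y \<in> {x. (x, 0) \<in> cspan D}"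
          using complex_vector.span_add[OF x, of "(y, 0)"] by simp
      qed (use complex_vector.span_zero[of D] in \<open>simp add: zero_prod_def\<close>)
    qed (auto simp: D_def intro: complex_vector.span_base)
    then show ?thesis using B by auto
  qed
  moreover have "(0, y) \<in> cspan D" for y
  proof -
    have "cspan C \<subseteq> {y. (0, y) \<in> cspan D}"
    proof (rule complex_vector.span_minimal)
      show "csubspace {y. (0, y) \<in> cspan D}"
        unfolding complex_vector.subspace_def
      proof (intro conjI ballI allI)
        fix c and x y :: 'b
        assume "x \<in> {x. (0, x) \<in> cspan D}"
        then have x: "(0, x) \<in> cspan D" by simp
        then show "c *\<^sub>C x \<in> {x. (0, x) \<in> cspan D}"
          using complex_vector.span_scale[OF x, of c]
          by (simp add: scaleC_prod_def scaleC_zero_right)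
        assume "y \<in> {x. (0, x) \<in> cspan D}"
        then show "x + y \<in> {x. (0, x) \<in> cspan D}"
          using complex_vector.span_add[OF x, of "(0, y)"] by simp
      qed (use complex_vector.span_zero[of D] in \<open>simp add: zero_prod_def\<close>)
    qed (auto simp: D_def intro: complex_vector.span_base)
    then show ?thesis using C by auto
  qed
  ultimately have "(x, y) \<in> cspan D" for x y
    using complex_vector.span_add[of "(x, 0)" D "(0, y)"] by simp
  then have "cspan D = UNIV" by auto
  moreover have "finite D" using B C by (simp add: D_def)
  ultimately show ?thesis unfolding finite_dim_def by blast
qed

lemma finite_dim_basis:
  assumes "finite_dim TYPE('a::complex_vector)"
  obtains B :: "'a::complex_vector set" where "finite_dimensional_vector_space scaleC B"
proof -
  obtain C :: "'a set" where C: "finite C" "cspan C = UNIV"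
    using assms unfolding finite_dim_def by blast
  obtain B where "B \<subseteq> C" "complex_vector.independent B" "C \<subseteq> cspan B"
    using complex_vector.maximal_independent_subset by blast
  moreover from this have "cspan B = UNIV"
    using C complex_vector.span_minimal[OF _ complex_vector.subspace_span] by blast
  moreover have "finite B" using C \<open>B \<subseteq> C\<close> finite_subset by blast
  ultimately have "finite_dimensional_vector_space scaleC B"
    by unfold_locales (simp_all add: cspan_def)
  then show ?thesis by (rule that)
qed

text \<open>The known bijection \<open>L\<close> replaces a comparison of dimensions:
  \<open>inv L \<circ> M\<close> is an injective endomorphism of a finite-dimensional space, hence
  surjective.\<close>

lemma clinear_inj_imp_bij:
  fixes L M :: "'a::complex_vector \<Rightarrow> 'b::complex_vector"
  assumes "finite_dim TYPE('a)" "clinear L" "bij L" "clinear M" "inj M"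
  shows "bij M"
proof -
  obtain B :: "'a set" where "finite_dimensional_vector_space scaleC B"
    using finite_dim_basis assms(1) by blast
  then interpret fd: finite_dimensional_vector_space scaleC B .
  have "clinear (inv L \<circ> M)" using assms by (intro clinear_compose clinear_inv)
  moreover have "inj (inv L \<circ> M)"
    by (rule inj_compose[OF bij_is_inj[OF bij_imp_bij_inv[OF assms(3)]] assms(5)])
  ultimately have "surj (inv L \<circ> M)" by (rule fd.linear_inj_imp_surj)
  then have "surj (L \<circ> (inv L \<circ> M))" by (rule comp_surj[OF _ bij_is_surj[OF assms(3)]])
  moreover have "L \<circ> (inv L \<circ> M) = M"
    using assms(3) by (auto simp: fun_eq_iff bij_def surj_f_inv_f)
  ultimately show ?thesis using assms(5) by (simp add: bij_def)
qed

text \<open>Choose \<open>k\<close> with \<open>V k\<close> of maximal dimension; every later member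
  contains \<open>V k\<close> and has no larger dimension.\<close>

lemma increasing_subspaces_stabilize:
  fixes V :: "nat \<Rightarrow> 'a::complex_vector set"
  assumes "finite_dim TYPE('a)" "\<And>j. csubspace (V j)" "\<And>i j. i \<le> j \<Longrightarrow> V i \<subseteq> V j"
  shows "\<exists>k. \<forall>j\<ge>k. V j = V k"
proof -
  obtain B :: "'a set" where "finite_dimensional_vector_space scaleC B"
    using finite_dim_basis assms(1) by blast
  then interpret fd: finite_dimensional_vector_space scaleC B .
  obtain k where k: "\<And>j. complex_vector.dim (V j) \<le> complex_vector.dim (V k)"
    using ex_has_greatest_nat[of "\<lambda>_. True" 0 "\<lambda>j. complex_vector.dim (V j)" "Suc fd.dimension"]
      fd.dim_subset_UNIV by (auto simp: less_Suc_eq_le)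
  have "V k = V j" if "j \<ge> k" for j
    using fd.subspace_dim_equal[folded csubspace_def, OF assms(2) assms(2) assms(3)[OF that]] k by blast
  then show ?thesis by auto
qed

lemma decreasing_subspaces_stabilize:
  fixes V :: "nat \<Rightarrow> 'a::complex_vector set"
  assumes "finite_dim TYPE('a)" "\<And>j. csubspace (V j)" "\<And>i j. i \<le> j \<Longrightarrow> V j \<subseteq> V i"
  shows "\<exists>k. \<forall>j\<ge>k. V j = V k"
proof -
  obtain B :: "'a set" where "finite_dimensional_vector_space scaleC B"
    using finite_dim_basis assms(1) by blast
  then interpret fd: finite_dimensional_vector_space scaleC B .
  obtain k where k: "\<And>j. complex_vector.dim (V k) \<le> complex_vector.dim (V j)"
    using ex_has_least_nat[of "\<lambda>_. True" 0 "\<lambda>j. complex_vector.dim (V j)"] by auto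
  have "V j = V k" if "j \<ge> k" for j
    using fd.subspace_dim_equal[folded csubspace_def, OF assms(2) assms(2) assms(3)[OF that]] k by blast
  then show ?thesis by auto
qed

section \<open>Fitting decomposition\<close>

lemma clinear_funpow:
  fixes T :: "'a::complex_vector \<Rightarrow> 'a"
  assumes "clinear T"
  shows "clinear (T ^^ k)"
proof (induction k)
  case 0
  show ?case by (rule clinearI) simp_all
next
  case (Suc k)
  then show ?case using clinear_compose[OF assms Suc] by (simp add: comp_def)
qed

lemma csubspace_range: "clinear T \<Longrightarrow> csubspace (range T)"
  unfolding complex_vector.subspace_def
  by (auto simp: image_iff) (metis clinear_0, metis clinear_add, metis clinear_scaleC)

lemma csubspace_kernel: "clinear T \<Longrightarrow> csubspace {x. T x = 0}"
  unfolding complex_vector.subspace_def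
  by (auto simp: clinear_0 clinear_add clinear_scaleC scaleC_zero_right)

text \<open>For large \<open>n\<close> both the ranges and the kernels of the powers are constant.
  Equal ranges of \<open>T ^^ n\<close> and \<open>T ^^ (n + n)\<close> give the sum decomposition,
  equal kernels the trivial intersection.\<close>

lemma fitting_decomposition:
  fixes T :: "'a::complex_vector \<Rightarrow> 'a"
  assumes fd: "finite_dim TYPE('a)" and T: "clinear T"
  obtains n where "n > 0" "\<And>x. \<exists>u\<in>range (T ^^ n). (T ^^ n) (x - u) = 0"
    "\<And>x. x \<in> range (T ^^ n) \<Longrightarrow> (T ^^ n) x = 0 \<Longrightarrow> x = 0"
proof -
  note Tk = clinear_funpow[OF T]
  have step: "(T ^^ j) x = (T ^^ (j - i)) ((T ^^ i) x)"
    "(T ^^ j) x = (T ^^ i) ((T ^^ (j - i)) x)" if "i \<le> j" for i j x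
    using that by (simp_all flip: funpow_add[unfolded comp_def fun_eq_iff, rule_format])
  have "\<exists>k. \<forall>j\<ge>k. range (T ^^ j) = range (T ^^ k)"
    by (rule decreasing_subspaces_stabilize[OF fd])
      (use Tk step(2) in \<open>auto intro: csubspace_range simp: image_iff\<close>)
  then obtain k where k: "\<And>j. j \<ge> k \<Longrightarrow> range (T ^^ j) = range (T ^^ k)" by blast
  have "\<exists>l. \<forall>j\<ge>l. {x. (T ^^ j) x = 0} = {x. (T ^^ l) x = 0}"
    by (rule increasing_subspaces_stabilize[OF fd])
      (use Tk step(1) in \<open>auto intro: csubspace_kernel simp: clinear_0\<close>)
  then obtain l where l: "\<And>j. j \<ge> l \<Longrightarrow> {x. (T ^^ j) x = 0} = {x. (T ^^ l) x = 0}" by blast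
  \<comment> \<open>The successor makes \<open>n\<close> positive, so that the kernel of
    \<open>T\<close> lies in that of \<open>T ^^ n\<close>.\<close>
  define n where "n = Suc (k + l)"
  have nn: "(T ^^ (n + n)) x = (T ^^ n) ((T ^^ n) x)" for x by (simp add: funpow_add)
  show ?thesis
  proof (rule that)
    show "n > 0" by (simp add: n_def)
    show "\<exists>u\<in>range (T ^^ n). (T ^^ n) (x - u) = 0" for x
    proof -
      have "range (T ^^ n) = range (T ^^ (n + n))"
        using k[of n] k[of "n + n"] by (simp add: n_def)
      then obtain y where "(T ^^ n) x = (T ^^ (n + n)) y" by blast
      then have "(T ^^ n) (x - (T ^^ n) y) = 0" by (simp add: clinear_diff[OF Tk] nn)
      then show ?thesis by blast
    qed
    show "x = 0" if "x \<in> range (T ^^ n)" "(T ^^ n) x = 0" for x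
    proof -
      obtain y where y: "x = (T ^^ n) y" using \<open>x \<in> range (T ^^ n)\<close> by blast
      have "{x. (T ^^ n) x = 0} = {x. (T ^^ (n + n)) x = 0}"
        using l[of n] l[of "n + n"] by (simp add: n_def)
      moreover have "(T ^^ (n + n)) y = 0" using that(2) by (simp add: y nn)
      ultimately show ?thesis unfolding y by blast
    qed
  qed
qed

text \<open>The projection onto \<open>U\<close> along \<open>V\<close>. It is chosen pointwise;
  uniqueness of the decomposition makes the choice linear.\<close>

lemma direct_sum_projection:
  fixes U V :: "'a::complex_vector set"
  assumes U: "csubspace U" and V: "csubspace V"
    and sum: "\<And>x. \<exists>u\<in>U. x - u \<in> V" and disj: "\<And>x. x \<in> U \<Longrightarrow> x \<in> V \<Longrightarrow> x = 0"
  obtains \<pi> where "clinear \<pi>" "\<And>x. \<pi> x \<in> U" "\<And>x. x - \<pi> x \<in> V"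
    "\<And>x u. u \<in> U \<Longrightarrow> x - u \<in> V \<Longrightarrow> \<pi> x = u"
proof -
  define \<pi> where "\<pi> x = (SOME u. u \<in> U \<and> x - u \<in> V)" for x
  have \<pi>: "\<pi> x \<in> U" "x - \<pi> x \<in> V" for x
    using someI_ex[of "\<lambda>u. u \<in> U \<and> x - u \<in> V"] sum[of x] by (auto simp: \<pi>_def)
  have eq: "\<pi> x = u" if "u \<in> U" "x - u \<in> V" for x u
  proof -
    have "\<pi> x - u \<in> U" using U \<pi> that by (intro complex_vector.subspace_diff)
    moreover have "(x - u) - (x - \<pi> x) \<in> V"
      by (rule complex_vector.subspace_diff[OF V that(2) \<pi>(2)])
    then have "\<pi> x - u \<in> V" by simp
    ultimately have "\<pi> x - u = 0" by (rule disj)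
    then show ?thesis by simp
  qed
  have "clinear \<pi>"
  proof (rule clinearI)
    fix x y :: 'a and c
    have "(x - \<pi> x) + (y - \<pi> y) \<in> V" using V \<pi> by (intro complex_vector.subspace_add)
    then show "\<pi> (x + y) = \<pi> x + \<pi> y"
      using U \<pi> by (intro eq complex_vector.subspace_add) (simp_all add: algebra_simps)
    have "c *\<^sub>C (x - \<pi> x) \<in> V" using V \<pi> by (intro complex_vector.subspace_scale)
    then show "\<pi> (c *\<^sub>C x) = c *\<^sub>C \<pi> x"
      using U \<pi> by (intro eq complex_vector.subspace_scale) (simp_all add: scaleC_diff_right)
  qed
  then show ?thesis using that \<pi> eq by blast
qed

section \<open>Existence of a Weierstrass form\<close>

lemma clinear_pencil: "clinear E \<Longrightarrow> clinear A \<Longrightarrow> clinear (pencil E A \<mu>)"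
  by (rule clinearI)
    (simp_all add: pencil_def clinear_add clinear_scaleC scaleC_add_right scaleC_scaleC
      scaleC_diff_right mult.commute)

text \<open>Composition with \<open>inv L\<close> turns the pair into \<open>(T, B)\<close> with
  \<open>B\<close> a polynomial in \<open>T\<close>. On the Fitting range \<open>Y1\<close> the map
  \<open>T\<close> is invertible; on the Fitting kernel \<open>Y2\<close> it is nilpotent and
  \<open>B\<close> is invertible. Dividing by \<open>T\<close> on \<open>Y1\<close> and by
  \<open>B\<close> on \<open>Y2\<close> gives the normal form.\<close>

lemma weierstrass_form_exists:
  fixes E A :: "'x::complex_hilbert \<Rightarrow> 'z::complex_hilbert"
  assumes fd: "finite_dim TYPE('x)" and E: "clinear E" and A: "clinear A"
    and \<mu>: "\<mu> \<in> resolvent_set E A"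
  shows "\<exists>Y1 Y2 A1 N. weierstrass_form E A Y1 Y2 A1 N"
proof -
  define L where "L = pencil E A \<mu>"
  have L: "clinear L" "bij L"
    using \<mu> clinear_pencil[OF E A] by (simp_all add: L_def resolvent_set_def)
  note L' = clinear_inv[OF L]
  define T where "T = inv L \<circ> E"
  have T: "clinear T" unfolding T_def by (intro clinear_compose L' E)
  note Tk = clinear_funpow[OF T]
  define B where "B x = \<mu> *\<^sub>C T x - x" for x
  have B: "clinear B"
    by (rule clinearI)
      (simp_all add: B_def clinear_add[OF T] clinear_scaleC[OF T] scaleC_add_right scaleC_scaleC
        scaleC_diff_right mult.commute)
  have LE: "inv L (E x) = T x" for x by (simp add: T_def)
  have LA: "inv L (A x) = B x" for x
  proof -
    have "A x = \<mu> *\<^sub>C E x - L x" by (simp add: L_def pencil_def)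
    then show ?thesis
      using L by (simp add: clinear_diff[OF L'] clinear_scaleC[OF L'] LE B_def bij_is_inj)
  qed
  obtain n where n: "n > 0" "\<And>x. \<exists>u\<in>range (T ^^ n). (T ^^ n) (x - u) = 0"
    "\<And>x. x \<in> range (T ^^ n) \<Longrightarrow> (T ^^ n) x = 0 \<Longrightarrow> x = 0"
    using fitting_decomposition[OF fd T] by blast
  define Y1 Y2 where "Y1 = range (T ^^ n)" and "Y2 = {x. (T ^^ n) x = 0}"
  have sub: "csubspace Y1" "csubspace Y2"
    unfolding Y1_def Y2_def by (intro csubspace_range csubspace_kernel Tk)+
  have disj: "x = 0" if "x \<in> Y1" "x \<in> Y2" for x
    using n(3) that by (simp add: Y1_def Y2_def)
  have sum: "\<exists>u\<in>Y1. x - u \<in> Y2" for x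
    using n(2)[of x] by (simp add: Y1_def Y2_def)
  obtain \<pi> where \<pi>: "clinear \<pi>" "\<And>x. \<pi> x \<in> Y1" "\<And>x. x - \<pi> x \<in> Y2"
    "\<And>x u. u \<in> Y1 \<Longrightarrow> x - u \<in> Y2 \<Longrightarrow> \<pi> x = u"
    by (rule direct_sum_projection[OF sub sum disj]) (assumption, assumption, rule that)
  have comm: "(T ^^ j) (T x) = T ((T ^^ j) x)" for j x by (simp add: funpow_swap1)
  have commB: "(T ^^ j) (B x) = B ((T ^^ j) x)" for j x
    by (simp add: B_def clinear_diff[OF Tk] clinear_scaleC[OF Tk] comm)
  have T1: "T x \<in> Y1" if "x \<in> Y1" for x
  proof -
    from that obtain y where "x = (T ^^ n) y" unfolding Y1_def by blast
    then have "T x = (T ^^ n) (T y)" by (simp add: comm)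
    then show ?thesis unfolding Y1_def by blast
  qed
  have T2: "T x \<in> Y2" if "x \<in> Y2" for x
    using that by (simp add: Y2_def comm clinear_0[OF T])
  have B1: "B x \<in> Y1" if "x \<in> Y1" for x
    unfolding B_def using sub T1 that
    by (intro complex_vector.subspace_diff complex_vector.subspace_scale)
  have B2: "B x \<in> Y2" if "x \<in> Y2" for x
    using that by (simp add: Y2_def commB clinear_0[OF B])
  have T1_inj: "x = 0" if "x \<in> Y1" "T x = 0" for x
  proof -
    obtain m where "n = Suc m" using n(1) gr0_implies_Suc by blast
    then have "(T ^^ n) x = 0"
      using that comm[of m x] clinear_0[OF Tk] by simp
    then show ?thesis using that disj by (simp add: Y2_def)
  qed
  \<comment> \<open>If \<open>B x = 0\<close>, then \<open>x\<close> is fixed by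
    \<open>\<mu>\<close> times \<open>T\<close>; iterating \<open>n\<close> times reaches
    \<open>T ^^ n\<close>, which vanishes on \<open>Y2\<close>.\<close>
  have B2_inj: "x = 0" if "x \<in> Y2" "B x = 0" for x
  proof -
    have x: "x = \<mu> *\<^sub>C T x" using that by (simp add: B_def)
    have "x = \<mu> ^ k *\<^sub>C (T ^^ k) x" for k
    proof (induction k)
      case (Suc k)
      have "(T ^^ k) x = \<mu> *\<^sub>C (T ^^ Suc k) x"
        using arg_cong[OF x, of "T ^^ k"] by (simp add: clinear_scaleC[OF Tk] comm)
      then have "x = \<mu> ^ k *\<^sub>C (\<mu> *\<^sub>C (T ^^ Suc k) x)" using Suc by metis
      then show ?case by (simp only: scaleC_scaleC power_Suc2)
    qed (simp add: scaleC_one)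
    from this[of n] show ?thesis using that by (simp add: Y2_def scaleC_zero_right)
  qed
  \<comment> \<open>\<open>S\<close> glues the two invertible blocks: it is \<open>T\<close> on
    \<open>Y1\<close> and \<open>B\<close> on \<open>Y2\<close>.\<close>
  define S where "S x = T (\<pi> x) + B (x - \<pi> x)" for x
  have S: "clinear S"
    by (rule clinearI)
      (simp_all add: S_def clinear_add[OF T] clinear_scaleC[OF T] clinear_add[OF B]
        clinear_diff[OF B] clinear_scaleC[OF B] clinear_add[OF \<pi>(1)] clinear_scaleC[OF \<pi>(1)]
        scaleC_add_right scaleC_diff_right)
  have S_split: "\<pi> (S x) = T (\<pi> x)" for x
    by (rule \<pi>(4)) (simp_all add: S_def T1 B2 \<pi>)
  have \<pi>1: "\<pi> x = x" if "x \<in> Y1" for x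
    using that sub by (intro \<pi>(4)) (simp_all add: complex_vector.subspace_0)
  have \<pi>2: "\<pi> x = 0" if "x \<in> Y2" for x
    using that sub by (intro \<pi>(4)) (simp_all add: complex_vector.subspace_0)
  have S1: "S x = T x" if "x \<in> Y1" for x using that by (simp add: S_def \<pi>1 clinear_0[OF B])
  have S2: "S x = B x" if "x \<in> Y2" for x using that by (simp add: S_def \<pi>2 clinear_0[OF T])
  \<comment> \<open>That \<open>S\<close> reflects membership in \<open>Y1\<close> and in
    \<open>Y2\<close> yields its injectivity and, later, that \<open>inv S \<circ> B\<close> and
    \<open>inv S \<circ> T\<close> preserve the respective subspaces.\<close>
  have Sz: "x \<in> Y2" if "S x \<in> Y2" for x
  proof -
    have "T (\<pi> x) = 0" using S_split[of x] \<pi>2[OF that] by simp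
    then have "\<pi> x = 0" by (rule T1_inj[OF \<pi>(2)])
    then show ?thesis using \<pi>(3)[of x] by simp
  qed
  have So: "x \<in> Y1" if "S x \<in> Y1" for x
  proof -
    have "B (x - \<pi> x) = 0" using S_split[of x] \<pi>1[OF that] by (simp add: S_def)
    then have "x - \<pi> x = 0" by (rule B2_inj[OF \<pi>(3)])
    then show ?thesis using \<pi>(2)[of x] by simp
  qed
  have "x = 0" if "S x = 0" for x
    using Sz[of x] So[of x] that sub by (intro disj) (simp_all add: complex_vector.subspace_0)
  then have "inj S" by (intro injI) (metis clinear_diff[OF S] right_minus_eq)
  moreover have "clinear id" "bij id" by (auto intro: clinearI)
  ultimately have bijS: "bij S" using clinear_inj_imp_bij[OF fd _ _ S] by blast
  note S' = clinear_inv[OF S bijS]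
  have SS: "S (inv S x) = x" "inv S (S x) = x" for x
    using bijS by (simp_all add: bij_is_inj bij_is_surj surj_f_inv_f)
  define A1 N where "A1 = inv S \<circ> B" and "N = inv S \<circ> T"
  have lin: "clinear A1" "clinear N"
    unfolding A1_def N_def by (intro clinear_compose S' T B)+
  have A1_in: "A1 x \<in> Y1" if "x \<in> Y1" for x
    by (rule So) (simp add: A1_def SS B1 that)
  have N_in: "N x \<in> Y2" if "x \<in> Y2" for x
    by (rule Sz) (simp add: N_def SS T2 that)
  have A1_id: "A1 x = x" if "x \<in> Y2" for x using S2[OF that] SS(2)[of x] by (simp add: A1_def)
  have N_id: "N x = x" if "x \<in> Y1" for x using S1[OF that] SS(2)[of x] by (simp add: N_def)
  \<comment> \<open>On \<open>Y2\<close> the map \<open>N\<close> is the inverse of \<open>B\<close>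
    after \<open>T\<close>. As \<open>B\<close> commutes with \<open>T\<close>, each application of
    \<open>N\<close> uses up one power of \<open>T\<close>.\<close>
  have nilp: "(N ^^ j) x = 0" if "x \<in> Y2" "(T ^^ j) x = 0" for j x
    using that
  proof (induction j arbitrary: x)
    case (Suc j)
    have TY: "(T ^^ i) y \<in> Y2" if "y \<in> Y2" for i y
      using that by (induction i) (auto intro: T2)
    have "S ((T ^^ j) (N x)) = B ((T ^^ j) (N x))" by (intro S2 TY N_in Suc.prems)
    also have "\<dots> = (T ^^ j) (S (N x))" by (simp add: commB S2 N_in Suc.prems)
    also have "\<dots> = 0" using Suc.prems by (simp add: N_def SS comm)
    finally have "(T ^^ j) (N x) = 0" using SS(2) clinear_0[OF S'] by metis
    then have "(N ^^ j) (N x) = 0" using Suc N_in by blast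
    then show ?case by (simp add: funpow_swap1)
  qed simp
  \<comment> \<open>\<open>P\<close> splits a vector into its Fitting components; \<open>Q\<close>
    first undoes \<open>L\<close> and \<open>S\<close>.\<close>
  define P where "P x = (\<pi> x, x - \<pi> x)" for x
  define Q where "Q = P \<circ> (inv S \<circ> inv L)"
  have P: "clinear P"
    by (rule clinearI)
      (simp_all add: P_def scaleC_prod_def clinear_add[OF \<pi>(1)] clinear_scaleC[OF \<pi>(1)]
        scaleC_diff_right)
  have bijP: "bij_betw P UNIV (Y1 \<times> Y2)"
  proof (rule bij_betwI')
    show "P x = P y \<longleftrightarrow> x = y" for x y by (auto simp: P_def)
    show "P x \<in> Y1 \<times> Y2" for x by (simp add: P_def \<pi>)
    fix y assume "y \<in> Y1 \<times> Y2"
    then obtain u v where y: "y = (u, v)" "u \<in> Y1" "v \<in> Y2" by blast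
    then have "\<pi> (u + v) = u" by (intro \<pi>(4)) simp_all
    then have "y = P (u + v)" using y by (simp add: P_def)
    then show "\<exists>x\<in>UNIV. y = P x" by blast
  qed
  have bij': "bij (inv S \<circ> inv L)" by (intro bij_comp bij_imp_bij_inv bijS L)
  have Q: "clinear Q" "bij_betw Q UNIV (Y1 \<times> Y2)"
    unfolding Q_def using bij_betw_trans[OF bij' bijP]
    by (auto intro: clinear_compose P S' L')
  then have injQ: "inj Q" by (simp add: bij_betw_def)
  have split: "\<pi> (u + v) = u" if "u \<in> Y1" "v \<in> Y2" for u v
    using that by (intro \<pi>(4)) simp_all
  have QE: "Q (E x) = (\<pi> x, N (x - \<pi> x))" for x
  proof -
    have "inv S (T x) = N (\<pi> x) + N (x - \<pi> x)"
      by (simp add: N_def flip: clinear_add[OF S'] clinear_add[OF T])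
    also have "\<dots> = \<pi> x + N (x - \<pi> x)" by (simp add: N_id \<pi>)
    finally show ?thesis by (simp add: Q_def LE P_def split N_in \<pi>)
  qed
  have QA: "Q (A x) = (A1 (\<pi> x), x - \<pi> x)" for x
  proof -
    have "inv S (B x) = A1 (\<pi> x) + A1 (x - \<pi> x)"
      by (simp add: A1_def flip: clinear_add[OF S'] clinear_add[OF B])
    also have "\<dots> = A1 (\<pi> x) + (x - \<pi> x)" by (simp add: A1_id \<pi>)
    finally show ?thesis by (simp add: Q_def LA P_def split A1_in \<pi>)
  qed
  have "equivalent_pairs E A (Y1 \<times> Y2) (Y1 \<times> Y2) (\<lambda>(u, v). (u, N v)) (\<lambda>(u, v). (A1 u, v))"
    unfolding equivalent_pairs_def
  proof (intro exI conjI)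
    show "E = inv Q \<circ> (\<lambda>(u, v). (u, N v)) \<circ> P"
      by (rule ext) (simp add: P_def inv_f_eq[OF injQ QE])
    show "A = inv Q \<circ> (\<lambda>(u, v). (A1 u, v)) \<circ> P"
      by (rule ext) (simp add: P_def inv_f_eq[OF injQ QA])
  qed (fact P bijP Q)+
  moreover have "bounded_on Y2 N"
    using bounded_linear.bounded[OF clinear_bounded_linear[OF fd lin(2)]]
    unfolding bounded_on_def by (metis mult.commute)
  moreover have "linear_endo_on Y1 A1" "linear_endo_on Y2 N"
    unfolding linear_endo_on_def
    by (auto simp: A1_in N_in clinear_add[OF lin(1)] clinear_add[OF lin(2)]
        clinear_scaleC[OF lin(1)] clinear_scaleC[OF lin(2)])
  moreover have "\<exists>p. \<forall>y\<in>Y2. (N ^^ p) y = 0"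
    using nilp[of _ n] by (auto simp: Y2_def)
  ultimately have "weierstrass_form E A Y1 Y2 A1 N"
    unfolding weierstrass_form_def using sub by simp
  then show ?thesis by blast
qed

section \<open>Ordered products of operators, and a growth argument\<close>

lemma comp_upto_0: "comp_upto F 0 = F 0"
  by (simp add: comp_upto_def)

lemma comp_upto_Suc: "comp_upto F (Suc p) = comp_upto F p \<circ> F (Suc p)"
proof -
  have "foldr (\<circ>) xs g = foldr (\<circ>) xs id \<circ> g" for xs and g :: "'a \<Rightarrow> 'a"
    by (induction xs) (simp_all add: comp_assoc)
  from this[of "map F [0..<Suc p]" "F (Suc p)"] show ?thesis
    by (simp add: comp_upto_def)
qed

lemma clinear_comp_upto: "(\<And>k. clinear (F k)) \<Longrightarrow> clinear (comp_upto F p)"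
  by (induction p) (simp_all only: comp_upto_0 comp_upto_Suc clinear_compose)

text \<open>The final contradiction in both lower bounds for the indices.\<close>

lemma linear_bounded_above_imp_False:
  fixes c M t0 :: real
  assumes "c > 0" "\<And>t. t > t0 \<Longrightarrow> c * t \<le> M"
  shows False
proof -
  define t where "t = max (t0 + 1) (M / c + 1)"
  have "c * (M / c + 1) \<le> c * t" using assms(1) by (intro mult_left_mono) (simp_all add: t_def)
  moreover have "c * t \<le> M" by (rule assms(2)) (simp add: t_def)
  ultimately show False using assms(1) by (simp add: distrib_left)
qed

lemma norm_fst_le_norm: "norm (fst w) \<le> norm w" and norm_snd_le_norm: "norm (snd w) \<le> norm w"
  by (metis norm_fst_le prod.collapse, metis norm_snd_le prod.collapse)

section \<open>Quantitative Weierstrass form and the finite Neumann series\<close>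

text \<open>A Weierstrass form with explicit constants. The equations for \<open>Q (E x)\<close> and
  \<open>Q (A x)\<close> avoid \<open>inv Q\<close>, and one \<open>K\<close> bounds
  \<open>P\<close>, \<open>Q\<close> and their inverses on \<open>Y1 \<times> Y2\<close>. The point
  \<open>\<mu>\<^sub>0\<close> provides one bijective pencil, against which injective pencils are
  compared.\<close>

locale bounded_weierstrass_form =
  fixes E A :: "'x::complex_hilbert \<Rightarrow> 'z::complex_hilbert"
    and Y1 Y2 :: "'x set" and A1 N :: "'x \<Rightarrow> 'x"
    and P :: "'x \<Rightarrow> 'x \<times> 'x" and Q :: "'z \<Rightarrow> 'x \<times> 'x" and a b K :: real and \<mu>\<^sub>0 :: complex
  assumes fdx: "finite_dim TYPE('x)" and fdz: "finite_dim TYPE('z)"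
    and E: "clinear E" and A: "clinear A"
    and Y1: "csubspace Y1" and Y2: "csubspace Y2"
    and A1: "linear_endo_on Y1 A1" and N: "linear_endo_on Y2 N"
    and nilp: "\<exists>p. \<forall>y\<in>Y2. (N ^^ p) y = 0"
    and P: "clinear P" and Q: "clinear Q"
    and P_in: "P x \<in> Y1 \<times> Y2" and Q_in: "Q z \<in> Y1 \<times> Y2"
    and P_surj: "w \<in> Y1 \<times> Y2 \<Longrightarrow> \<exists>x. P x = w" and Q_surj: "w \<in> Y1 \<times> Y2 \<Longrightarrow> \<exists>z. Q z = w"
    and QE: "Q (E x) = (fst (P x), N (snd (P x)))"
    and QA: "Q (A x) = (A1 (fst (P x)), snd (P x))"
    and K: "K > 0"
    and P_le: "norm (P x) \<le> K * norm x" and P_ge: "norm x \<le> K * norm (P x)"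
    and Q_le: "norm (Q z) \<le> K * norm z" and Q_ge: "norm z \<le> K * norm (Q z)"
    and a: "a \<ge> 0" and A1_le: "u \<in> Y1 \<Longrightarrow> norm (A1 u) \<le> a * norm u"
    and b: "b \<ge> 0" and N_le: "v \<in> Y2 \<Longrightarrow> norm (N v) \<le> b * norm v"
    and \<mu>\<^sub>0: "\<mu>\<^sub>0 \<in> resolvent_set E A"
begin

abbreviation d where "d \<equiv> nilpotency_degree Y2 N"

lemma in_Y: "fst (P x) \<in> Y1" "snd (P x) \<in> Y2" "fst (Q z) \<in> Y1" "snd (Q z) \<in> Y2"
  using P_in[of x] Q_in[of z] by (simp_all add: mem_Times_iff)

lemma N_in: "v \<in> Y2 \<Longrightarrow> N v \<in> Y2"
  and N_add: "v \<in> Y2 \<Longrightarrow> w \<in> Y2 \<Longrightarrow> N (v + w) = N v + N w"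
  and N_scale: "v \<in> Y2 \<Longrightarrow> N (c *\<^sub>C v) = c *\<^sub>C N v"
  using N by (auto simp: linear_endo_on_def)

lemma Nk_in: "v \<in> Y2 \<Longrightarrow> (N ^^ k) v \<in> Y2"
  by (induction k) (auto intro: N_in)

lemma Nk_scale: "v \<in> Y2 \<Longrightarrow> (N ^^ k) (c *\<^sub>C v) = c *\<^sub>C (N ^^ k) v"
  by (induction k) (simp_all add: N_scale Nk_in)

lemma Nk_add: "v \<in> Y2 \<Longrightarrow> w \<in> Y2 \<Longrightarrow> (N ^^ k) (v + w) = (N ^^ k) v + (N ^^ k) w"
  by (induction k) (simp_all add: N_add Nk_in)

lemma Nk_0: "(N ^^ k) 0 = 0"
  using Nk_scale[of 0 k 0] Y2 by (simp add: complex_vector.subspace_0)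

lemma Nk_diff: "v \<in> Y2 \<Longrightarrow> w \<in> Y2 \<Longrightarrow> (N ^^ k) (v - w) = (N ^^ k) v - (N ^^ k) w"
  using Nk_add[of "v - w" w k] Y2 by (simp add: complex_vector.subspace_diff)

lemma Nk_N: "(N ^^ k) (N v) = (N ^^ Suc k) v"
  by (simp add: funpow_swap1)

lemma Nk_le: "v \<in> Y2 \<Longrightarrow> norm ((N ^^ k) v) \<le> b ^ k * norm v"
proof (induction k)
  case (Suc k)
  have "norm ((N ^^ Suc k) v) \<le> b * norm ((N ^^ k) v)" using N_le Nk_in Suc.prems by simp
  also have "\<dots> \<le> b * (b ^ k * norm v)" using Suc b by (intro mult_left_mono) auto
  finally show ?case by simp
qed simp

lemma Nd: "y \<in> Y2 \<Longrightarrow> (N ^^ d) y = 0"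
  using LeastI_ex[OF nilp] unfolding nilpotency_degree_def by blast

lemma less_d: "k < d \<Longrightarrow> \<exists>y\<in>Y2. (N ^^ k) y \<noteq> 0"
  using not_less_Least[of k "\<lambda>p. \<forall>y\<in>Y2. (N ^^ p) y = 0"] unfolding nilpotency_degree_def by blast

text \<open>Repeated substitution of \<open>v = c *\<^sub>C N v - g\<close> into itself, with the
  remainder after \<open>m\<close> rounds.\<close>

lemma neumann_expansion:
  assumes "v \<in> Y2" "g \<in> Y2" "c *\<^sub>C N v - v = g"
  shows "v = c ^ m *\<^sub>C (N ^^ m) v - (\<Sum>k<m. c ^ k *\<^sub>C (N ^^ k) g)"
proof (induction m)
  case 0
  show ?case by (simp add: scaleC_one)
next
  case (Suc m)
  have "(N ^^ m) g = c *\<^sub>C (N ^^ Suc m) v - (N ^^ m) v"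
    using assms Y2 unfolding assms(3)[symmetric]
    by (simp add: Nk_diff Nk_scale N_in complex_vector.subspace_scale Nk_N del: funpow.simps)
  then have "(N ^^ m) v = c *\<^sub>C (N ^^ Suc m) v - (N ^^ m) g" by simp
  then have "c ^ m *\<^sub>C (N ^^ m) v = c ^ Suc m *\<^sub>C (N ^^ Suc m) v - c ^ m *\<^sub>C (N ^^ m) g"
    by (simp only: scaleC_diff_right scaleC_scaleC power_Suc2)
  with Suc show ?case by (simp add: algebra_simps del: funpow.simps power_Suc)
qed

text \<open>At \<open>m = d\<close> the remainder vanishes, which leaves the finite Neumann series
  for the inverse of \<open>c N - 1\<close>.\<close>

lemma neumann_sum:
  assumes "v \<in> Y2" "g \<in> Y2" "c *\<^sub>C N v - v = g"
  shows "v = - (\<Sum>k<d. c ^ k *\<^sub>C (N ^^ k) g)"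
  using neumann_expansion[OF assms, of d] assms(1) by (simp add: Nd scaleC_zero_right)

lemma fixed_zero: "v \<in> Y2 \<Longrightarrow> v = c *\<^sub>C N v \<Longrightarrow> v = 0"
  using neumann_sum[of v 0 c] Y2 by (simp add: Nk_0 scaleC_zero_right complex_vector.subspace_0)

text \<open>Triangle inequality. The bound has no constant in front of
  \<open>1 / (\<nu> - a)\<close>, so products of many factors accumulate none.\<close>

lemma A1_estimate:
  assumes "u \<in> Y1" "complex_of_real \<nu> *\<^sub>C u - A1 u = f" "\<nu> > a"
  shows "norm u \<le> 1 / (\<nu> - a) * norm f"
proof -
  have "\<nu> * norm u = norm (f + A1 u)"
    using assms a by (simp add: norm_scaleC flip: assms(2))
  also have "\<dots> \<le> norm f + a * norm u" using norm_triangle_ineq[of f "A1 u"] A1_le[OF assms(1)] by simp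
  finally show ?thesis using assms(3) by (simp add: field_simps)
qed

lemma Q_pencil:
  "fst (Q (pencil E A c x)) = c *\<^sub>C fst (P x) - A1 (fst (P x))"
  "snd (Q (pencil E A c x)) = c *\<^sub>C N (snd (P x)) - snd (P x)"
  by (simp_all add: pencil_def clinear_diff[OF Q] clinear_scaleC[OF Q] QE QA scaleC_prod_def)

text \<open>A kernel vector of the pencil has first component zero by \<open>A1_estimate\<close> and
  second component zero by \<open>fixed_zero\<close>. Injectivity then gives bijectivity by
  comparison with the pencil at \<open>\<mu>\<^sub>0\<close>.\<close>

lemma resolvent_set_mem:
  assumes "\<nu> > a"
  shows "complex_of_real \<nu> \<in> resolvent_set E A"
proof -
  let ?L = "pencil E A (complex_of_real \<nu>)"
  note L = clinear_pencil[OF E A, of "complex_of_real \<nu>"]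
  have "x = 0" if "?L x = 0" for x
  proof -
    have Q0: "Q (?L x) = 0" using that clinear_0[OF Q] by simp
    have "norm (fst (P x)) \<le> 1 / (\<nu> - a) * norm (fst (Q (?L x)))"
      by (rule A1_estimate[OF in_Y(1) Q_pencil(1)[symmetric] assms])
    then have "fst (P x) = 0" by (simp add: Q0)
    moreover have "snd (P x) = 0"
      using Q_pencil(2)[of "complex_of_real \<nu>" x] by (intro fixed_zero[where c = "complex_of_real \<nu>", OF in_Y(2)]) (simp add: Q0)
    ultimately have "norm (P x) = 0" by (simp add: norm_prod_def)
    then show "x = 0" using P_ge[of x] by simp
  qed
  then have "inj ?L" by (intro injI) (metis clinear_diff[OF L] right_minus_eq)
  then show ?thesis
    using clinear_inj_imp_bij[OF fdx clinear_pencil[OF E A] _ L] \<mu>\<^sub>0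
    unfolding resolvent_set_def by blast
qed

abbreviation R where "R \<equiv> resolvent E A"

lemma pencil_R: "\<nu> > a \<Longrightarrow> pencil E A (complex_of_real \<nu>) (R \<nu> z) = z"
  using resolvent_set_mem[of \<nu>] by (simp add: resolvent_set_def resolvent_def bij_is_surj surj_f_inv_f)

lemma clinear_R: "\<nu> > a \<Longrightarrow> clinear (R \<nu>)"
  using resolvent_set_mem[of \<nu>] unfolding resolvent_set_def resolvent_def
  by (intro clinear_inv clinear_pencil E A) simp

text \<open>In the coordinates \<open>P\<close> and \<open>Q\<close> the operators \<open>R \<nu> \<circ> E\<close> and \<open>E \<circ> R \<nu>\<close> coincide; \<open>step \<nu> w w'\<close>
  says that this common operator maps \<open>w\<close> to \<open>w'\<close>.\<close>

definition step :: "real \<Rightarrow> 'x \<times> 'x \<Rightarrow> 'x \<times> 'x \<Rightarrow> bool" where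
  "step \<nu> w w' \<longleftrightarrow> \<nu> > a \<and> w \<in> Y1 \<times> Y2 \<and> w' \<in> Y1 \<times> Y2 \<and>
     complex_of_real \<nu> *\<^sub>C fst w' - A1 (fst w') = fst w \<and>
     complex_of_real \<nu> *\<^sub>C N (snd w') - snd w' = N (snd w)"

lemma step_P: "\<nu> > a \<Longrightarrow> step \<nu> (P x) (P ((R \<nu> \<circ> E) x))"
  using Q_pencil[of "complex_of_real \<nu>" "R \<nu> (E x)"]
  by (simp add: step_def P_in pencil_R QE)

lemma step_Q:
  assumes "\<nu> > a"
  shows "step \<nu> (Q z) (Q ((E \<circ> R \<nu>) z))"
proof -
  let ?v = "snd (P (R \<nu> z))"
  have "snd (Q z) = complex_of_real \<nu> *\<^sub>C N ?v - ?v"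
    using Q_pencil(2)[of "complex_of_real \<nu>" "R \<nu> z"] assms by (simp add: pencil_R)
  \<comment> \<open>The second component of \<open>Q (E (R \<nu> z))\<close> is \<open>N ?v\<close>,
    so \<open>N\<close> is applied to the relation for \<open>?v\<close>.\<close>
  then have "N (snd (Q z)) = complex_of_real \<nu> *\<^sub>C N (N ?v) - N ?v"
    using Nk_diff[of "complex_of_real \<nu> *\<^sub>C N ?v" ?v 1] Y2
    by (simp add: in_Y N_in N_scale complex_vector.subspace_scale)
  then show ?thesis
    using Q_pencil(1)[of "complex_of_real \<nu>" "R \<nu> z"] assms Q_in[of "E (R \<nu> z)"]
    by (simp add: step_def Q_in pencil_R QE)
qed

lemma step_fst: "step \<nu> w w' \<Longrightarrow> norm (fst w') \<le> 1 / (\<nu> - a) * norm (fst w)"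
  by (intro A1_estimate) (auto simp: step_def)

lemma step_snd_eq:
  assumes "step \<nu> w w'"
  shows "complex_of_real \<nu> *\<^sub>C (N ^^ Suc j) (snd w') - (N ^^ j) (snd w') = (N ^^ Suc j) (snd w)"
proof -
  have w: "snd w \<in> Y2" "snd w' \<in> Y2" "complex_of_real \<nu> *\<^sub>C N (snd w') - snd w' = N (snd w)"
    using assms by (auto simp: step_def)
  from arg_cong[OF w(3), of "N ^^ j"] show ?thesis
    using w(1,2) Y2
    by (simp add: Nk_diff Nk_scale N_in complex_vector.subspace_scale Nk_N del: funpow.simps)
qed

text \<open>One step lowers the annihilating power of \<open>N\<close> by one: the vector in
  question is fixed by \<open>\<nu>\<close> times \<open>N\<close>, hence zero.\<close>

lemma step_snd_zero:
  assumes st: "step \<nu> w w'" and "(N ^^ Suc j) (snd w) = 0"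
  shows "(N ^^ j) (snd w') = 0"
proof (rule fixed_zero)
  show "(N ^^ j) (snd w') \<in> Y2" using st by (auto simp: step_def intro: Nk_in)
  show "(N ^^ j) (snd w') = complex_of_real \<nu> *\<^sub>C N ((N ^^ j) (snd w'))"
    using step_snd_eq[OF st, of j] assms(2) by simp
qed

text \<open>By \<open>step_snd_zero\<close> the term with the factor \<open>\<nu>\<close> drops out
  of \<open>step_snd_eq\<close>. What remains does not depend on \<open>\<nu>\<close>, which is the
  source of the missing decay.\<close>

lemma step_snd:
  assumes "step \<nu> w w'" "(N ^^ Suc (Suc j)) (snd w) = 0"
  shows "(N ^^ j) (snd w') = - (N ^^ Suc j) (snd w)"
  using step_snd_eq[OF assms(1), of j] step_snd_zero[OF assms]
  by (simp add: scaleC_zero_right del: funpow.simps) (metis minus_minus)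

section \<open>Products of several resolvent factors\<close>

text \<open>Here and below \<open>J\<close> stands for \<open>P\<close> with factors
  \<open>R \<circ> E\<close>, or for \<open>Q\<close> with factors \<open>E \<circ> R\<close>, so
  that one induction serves both products.\<close>

lemma comp_fst_le:
  assumes "\<And>k x. k \<le> p \<Longrightarrow> step (\<nu> k) (J x) (J (F k x))"
  shows "norm (fst (J (comp_upto F p x))) \<le> (\<Prod>k\<le>p. 1 / (\<nu> k - a)) * norm (fst (J x))"
  using assms
proof (induction p arbitrary: x)
  case 0
  then show ?case using step_fst by (simp add: comp_upto_0)
next
  case (Suc p)
  have pos: "\<nu> k > a" if "k \<le> p" for k using Suc.prems[of k] that by (simp add: step_def)
  have "norm (fst (J (comp_upto F p (F (Suc p) x))))
      \<le> (\<Prod>k\<le>p. 1 / (\<nu> k - a)) * norm (fst (J (F (Suc p) x)))"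
    using Suc by simp
  also have "\<dots> \<le> (\<Prod>k\<le>p. 1 / (\<nu> k - a)) * (1 / (\<nu> (Suc p) - a) * norm (fst (J x)))"
    using pos by (intro mult_left_mono step_fst Suc.prems prod_nonneg) (auto simp: less_imp_le)
  finally show ?case by (simp add: comp_upto_Suc mult.assoc)
qed

lemma comp_snd_zero:
  assumes "\<And>k x. k \<le> p \<Longrightarrow> step (\<nu> k) (J x) (J (F k x))" and "(N ^^ (j + Suc p)) (snd (J x)) = 0"
  shows "(N ^^ j) (snd (J (comp_upto F p x))) = 0"
  using assms
proof (induction p arbitrary: x)
  case 0
  then show ?case using step_snd_zero[of "\<nu> 0" "J x"] by (simp add: comp_upto_0)
next
  case (Suc p)
  have "(N ^^ (j + Suc p)) (snd (J (F (Suc p) x))) = 0"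
  proof (rule step_snd_zero)
    show "step (\<nu> (Suc p)) (J x) (J (F (Suc p) x))" by (rule Suc.prems) simp
    show "(N ^^ Suc (j + Suc p)) (snd (J x)) = 0" using Suc.prems(2) by (simp only: add_Suc_right)
  qed
  then have "(N ^^ j) (snd (J (comp_upto F p (F (Suc p) x)))) = 0"
    by (intro Suc.IH Suc.prems) simp_all
  then show ?case by (simp add: comp_upto_Suc)
qed

text \<open>At least \<open>d\<close> factors annihilate the nilpotent component, and the other one
  decays with every factor. Entering and leaving the coordinates costs one \<open>K\<close>
  each.\<close>

lemma comp_upto_le:
  assumes step: "\<And>k x. k \<le> p \<Longrightarrow> step (\<nu> k) (J x) (J (F k x))" and "d \<le> Suc p"
    and J: "\<And>x. J x \<in> Y1 \<times> Y2" "\<And>x. norm (J x) \<le> K * norm x" "\<And>x. norm x \<le> K * norm (J x)"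
  shows "norm (comp_upto F p x) \<le> (K * K) * (\<Prod>k\<le>p. 1 / \<bar>\<nu> k - a\<bar>) * norm x"
proof -
  let ?y = "comp_upto F p x" and ?C = "\<Prod>k\<le>p. 1 / (\<nu> k - a)"
  have pos: "\<nu> k > a" if "k \<le> p" for k using step[OF that] by (simp add: step_def)
  have "snd (J x) \<in> Y2" using J(1)[of x] by (simp add: mem_Times_iff)
  moreover obtain m where m: "Suc p = m + d" using \<open>d \<le> Suc p\<close> by (metis le_add_diff_inverse2)
  ultimately have "(N ^^ Suc p) (snd (J x)) = 0" unfolding m by (simp add: funpow_add Nd Nk_0)
  then have "snd (J ?y) = 0" using comp_snd_zero[where J = J and F = F and \<nu> = \<nu> and j = 0, OF step] by simp
  then have "norm (J ?y) = norm (fst (J ?y))" by (simp add: norm_prod_def)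
  also have "\<dots> \<le> ?C * norm (fst (J x))" by (rule comp_fst_le[where J = J and F = F and \<nu> = \<nu>, OF step])
  also have "\<dots> \<le> ?C * (K * norm x)"
    using pos order_trans[OF norm_fst_le_norm J(2)]
    by (intro mult_left_mono prod_nonneg) (auto simp: less_imp_le)
  finally have "K * norm (J ?y) \<le> K * (?C * (K * norm x))" using K by (intro mult_left_mono) auto
  then have "norm ?y \<le> K * K * ?C * norm x" using J(3)[of ?y] by (simp add: algebra_simps)
  moreover have "(\<Prod>k\<le>p. 1 / \<bar>\<nu> k - a\<bar>) = ?C" using pos by (intro prod.cong) (auto simp: less_imp_le)
  ultimately show ?thesis by simp
qed

text \<open>Each factor acts as \<open>N\<close> up to sign. The hypothesis that the next power of
  \<open>N\<close> vanishes is passed on from factor to factor by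
  \<open>step_snd_zero\<close>.\<close>

lemma norm_comp_snd:
  assumes "\<And>x. step \<nu> (J x) (J (F x))" and "(N ^^ Suc (j + Suc p)) (snd (J x)) = 0"
  shows "norm ((N ^^ j) (snd (J (comp_upto (\<lambda>_. F) p x)))) = norm ((N ^^ (j + Suc p)) (snd (J x)))"
  using assms(2)
proof (induction p arbitrary: x)
  case 0
  then show ?case using step_snd[OF assms(1)] by (simp add: comp_upto_0)
next
  case (Suc p)
  have "(N ^^ Suc (j + Suc p)) (snd (J (F x))) = 0"
    using Suc.prems by (intro step_snd_zero[OF assms(1)]) (simp only: add_Suc_right)
  moreover have "(N ^^ (j + Suc p)) (snd (J (F x))) = - (N ^^ Suc (j + Suc p)) (snd (J x))"
    using Suc.prems by (intro step_snd[OF assms(1)]) (simp only: add_Suc_right)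
  ultimately show ?case
    using Suc.IH[of "F x"] by (simp only: comp_upto_Suc comp_apply norm_minus_cancel add_Suc_right)
qed

section \<open>The radiality index\<close>

text \<open>The choice \<open>\<omega> = a\<close> works for \<open>d\<close> factors. With fewer
  factors some vector keeps a fixed positive norm in the nilpotent component, while the required
  bound tends to zero.\<close>

lemma rad_index_eq:
  assumes "d > 0"
  shows "rad_index E A = d - 1"
  unfolding rad_index_def
proof (rule Least_equality)
  have "onorm (comp_upto (\<lambda>k. R (\<nu> k) \<circ> E) (d - 1)) \<le> K * K * (\<Prod>k\<le>d - 1. 1 / \<bar>\<nu> k - a\<bar>)"
    "onorm (comp_upto (\<lambda>k. E \<circ> R (\<nu> k)) (d - 1)) \<le> K * K * (\<Prod>k\<le>d - 1. 1 / \<bar>\<nu> k - a\<bar>)"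
    if "\<forall>k\<le>d - 1. \<nu> k > a" for \<nu> :: "nat \<Rightarrow> real"
    using K that assms
    by (intro onorm_bound comp_upto_le[where J = P] comp_upto_le[where J = Q];
        auto intro!: mult_nonneg_nonneg prod_nonneg step_P step_Q P_in Q_in P_le P_ge Q_le Q_ge
          simp del: comp_apply)+
  then show "\<exists>\<omega>. \<exists>C>0. complex_of_real ` {\<omega><..} \<subseteq> resolvent_set E A \<and>
      (\<forall>\<mu>. (\<forall>k\<le>d - 1. \<omega> < \<mu> k) \<longrightarrow>
        onorm (comp_upto (\<lambda>k. R (\<mu> k) \<circ> E) (d - 1)) \<le> C * (\<Prod>k\<le>d - 1. 1 / \<bar>\<mu> k - \<omega>\<bar>) \<and>
        onorm (comp_upto (\<lambda>k. E \<circ> R (\<mu> k)) (d - 1)) \<le> C * (\<Prod>k\<le>d - 1. 1 / \<bar>\<mu> k - \<omega>\<bar>))"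
    using K resolvent_set_mem by (intro exI[of _ a] exI[of _ "K * K"]) auto
next
  fix p
  assume "\<exists>\<omega>. \<exists>C>0. complex_of_real ` {\<omega><..} \<subseteq> resolvent_set E A \<and>
      (\<forall>\<mu>. (\<forall>k\<le>p. \<omega> < \<mu> k) \<longrightarrow>
        onorm (comp_upto (\<lambda>k. R (\<mu> k) \<circ> E) p) \<le> C * (\<Prod>k\<le>p. 1 / \<bar>\<mu> k - \<omega>\<bar>) \<and>
        onorm (comp_upto (\<lambda>k. E \<circ> R (\<mu> k)) p) \<le> C * (\<Prod>k\<le>p. 1 / \<bar>\<mu> k - \<omega>\<bar>))"
  then obtain \<omega> C where C: "C > 0"
    and bound: "\<And>\<mu>. \<forall>k\<le>p. \<omega> < \<mu> k \<Longrightarrow>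
        onorm (comp_upto (\<lambda>k. R (\<mu> k) \<circ> E) p) \<le> C * (\<Prod>k\<le>p. 1 / \<bar>\<mu> k - \<omega>\<bar>)"
    by blast
  show "d - 1 \<le> p"
  proof (rule ccontr)
    assume "\<not> d - 1 \<le> p"
    then have "d = Suc ((d - Suc (Suc p)) + Suc p)" by simp
    then obtain m where m: "d = Suc (m + Suc p)" by blast
    obtain y where y: "y \<in> Y2" "(N ^^ (m + Suc p)) y \<noteq> 0" using less_d[of "m + Suc p"] m by auto
    \<comment> \<open>Pushing \<open>y\<close> forward by \<open>m\<close> powers makes
      \<open>p + 2\<close> the first power of \<open>N\<close> that kills \<open>v\<close>.\<close>
    define v where "v = (N ^^ m) y"
    have v: "v \<in> Y2" "(N ^^ Suc p) v \<noteq> 0" "(N ^^ Suc (Suc p)) v = 0"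
    proof -
      show "v \<in> Y2" using y by (simp add: v_def Nk_in)
      have *: "(N ^^ k) v = (N ^^ (k + m)) y" for k by (simp add: v_def funpow_add)
      show "(N ^^ Suc p) v \<noteq> 0" using y unfolding * by (simp only: add.commute) simp
      show "(N ^^ Suc (Suc p)) v = 0" using Nd[OF y(1)] unfolding * m by (simp add: add.commute)
    qed
    obtain x where x: "P x = (0, v)"
      using P_surj[of "(0, v)"] v(1) Y1 by (auto simp: complex_vector.subspace_0)
    define c where "c = norm ((N ^^ Suc p) v)"
    have "c > 0" using v by (simp add: c_def)
    moreover have "c * t \<le> K * C * norm x" if "t > 1" for t
    proof -
      \<comment> \<open>All parameters of the product are taken equal to this \<open>\<nu>\<close>,
        which lies beyond \<open>a\<close> and at distance at least \<open>t\<close> from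
        \<open>\<omega>\<close>.\<close>
      define \<nu> where "\<nu> = max a \<omega> + t"
      have \<nu>: "\<nu> > a" "\<nu> > \<omega>" "t \<le> \<bar>\<nu> - \<omega>\<bar>" using that by (auto simp: \<nu>_def)
      let ?F = "comp_upto (\<lambda>_. R \<nu> \<circ> E) p"
      have bl: "bounded_linear ?F"
        by (intro clinear_bounded_linear[OF fdx] clinear_comp_upto clinear_compose clinear_R E \<nu>)
      have "norm ((N ^^ 0) (snd (P (?F x)))) = norm ((N ^^ (0 + Suc p)) (snd (P x)))"
      proof (rule norm_comp_snd)
        show "step \<nu> (P x') (P ((R \<nu> \<circ> E) x'))" for x' by (rule step_P[OF \<nu>(1)])
        show "(N ^^ Suc (0 + Suc p)) (snd (P x)) = 0" using v(3) by (simp add: x)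
      qed
      then have "c = norm (snd (P (?F x)))" by (simp add: x c_def)
      also have "\<dots> \<le> norm (P (?F x))" by (rule norm_snd_le_norm)
      also have "\<dots> \<le> K * norm (?F x)" by (rule P_le)
      also have "\<dots> \<le> K * (onorm ?F * norm x)"
        using K onorm[OF bl] by (intro mult_left_mono) auto
      also have "\<dots> \<le> K * (C * (1 / t) * norm x)"
      proof (intro mult_left_mono mult_right_mono)
        have "onorm ?F \<le> C * (1 / \<bar>\<nu> - \<omega>\<bar>) ^ Suc p" using bound[of "\<lambda>_. \<nu>"] \<nu> by simp
        also have "(1 / \<bar>\<nu> - \<omega>\<bar>) ^ Suc p \<le> (1 / t) ^ Suc p"
          using \<nu> that by (intro power_mono divide_left_mono) auto
        \<comment> \<open>There is at least one factor and \<open>t > 1\<close>, so decay of order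
          \<open>1 / t\<close> can be kept for every \<open>p\<close>.\<close>
        also have "(1 / t) ^ Suc p \<le> (1 / t) ^ 1" using that by (intro power_decreasing) auto
        finally show "onorm ?F \<le> C * (1 / t)" using C by simp
      qed (use K in auto)
      finally show ?thesis using that by (simp add: field_simps)
    qed
    ultimately show False by (rule linear_bounded_above_imp_False)
  qed
qed

section \<open>The resolvent index\<close>

text \<open>The Neumann series is a polynomial in \<open>\<nu>\<close> of degree
  \<open>d - 1\<close> if \<open>d > 0\<close>, and its leading coefficient
  \<open>N ^^ (d - 1)\<close> is nonzero. The \<open>Y1\<close> block is of order
  \<open>1 / \<nu>\<close>, which fits the exponent \<open>-1\<close> if
  \<open>d = 0\<close>.\<close>

lemma res_index_eq: "res_index E A = d"
  unfolding res_index_def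
proof (rule Least_equality)
  \<comment> \<open>This \<open>\<omega>\<close> ensures \<open>\<nu> \<ge> 1\<close> and
    \<open>\<nu> / 2 \<le> \<nu> - a\<close>. In \<open>C\<close>, the 2 comes from the
    \<open>Y1\<close> block, the sum from the Neumann series and \<open>K * K\<close> from the
    coordinates.\<close>
  define \<omega> C where "\<omega> = 2 * a + 1" and "C = K * K * (2 + (\<Sum>k<d. b ^ k))"
  have Cpos: "C > 0" using K b unfolding C_def
    by (intro mult_pos_pos add_pos_nonneg sum_nonneg) auto
  have "onorm (R \<nu>) \<le> C * \<bar>\<nu>\<bar> powi (int d - 1)" if "\<nu> > \<omega>" for \<nu>
  proof (rule onorm_bound)
    have \<nu>: "\<nu> > a" "\<nu> \<ge> 1" "\<nu> / 2 \<le> \<nu> - a" using that a by (auto simp: \<omega>_def field_simps)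
    let ?e = "\<nu> powi (int d - 1)"
    show "0 \<le> C * \<bar>\<nu>\<bar> powi (int d - 1)" using Cpos by simp
    fix z
    let ?u = "fst (P (R \<nu> z))" and ?v = "snd (P (R \<nu> z))"
    have uv: "complex_of_real \<nu> *\<^sub>C ?u - A1 ?u = fst (Q z)"
      "complex_of_real \<nu> *\<^sub>C N ?v - ?v = snd (Q z)"
      using Q_pencil[of "complex_of_real \<nu>" "R \<nu> z"] \<nu>(1) by (simp_all add: pencil_R)
    have Qz: "norm (fst (Q z)) \<le> K * norm z" "norm (snd (Q z)) \<le> K * norm z"
      using order_trans[OF norm_fst_le_norm Q_le] order_trans[OF norm_snd_le_norm Q_le] by auto
    have e: "\<nu> ^ k \<le> ?e" if "k < d" for k
      using power_int_increasing[of "int k" "int d - 1" \<nu>] that \<nu>(2) by simp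
    have "norm ?u \<le> 1 / (\<nu> - a) * norm (fst (Q z))"
      by (rule A1_estimate[OF in_Y(1) uv(1) \<nu>(1)])
    also have "\<dots> \<le> (2 * ?e) * (K * norm z)"
    proof (rule mult_mono)
      have "1 / (\<nu> - a) \<le> 1 / (\<nu> / 2)" using \<nu> by (intro divide_left_mono) auto
      also have "\<dots> = 2 * \<nu> powi (-1)" by (simp add: power_int_minus field_simps)
      also have "\<dots> \<le> 2 * ?e" using \<nu> by (intro mult_left_mono power_int_increasing) auto
      finally show "1 / (\<nu> - a) \<le> 2 * ?e" .
    qed (use Qz \<nu> in auto)
    finally have u: "norm ?u \<le> 2 * ?e * (K * norm z)" .
    have "norm ?v = norm (\<Sum>k<d. complex_of_real \<nu> ^ k *\<^sub>C (N ^^ k) (snd (Q z)))"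
      using arg_cong[OF neumann_sum[OF in_Y(2) in_Y(4) uv(2)], of norm] by simp
    also have "\<dots> \<le> (\<Sum>k<d. ?e * b ^ k * (K * norm z))"
    proof (rule sum_norm_le)
      fix k assume k: "k \<in> {..<d}"
      have "norm (complex_of_real \<nu> ^ k *\<^sub>C (N ^^ k) (snd (Q z))) = \<nu> ^ k * norm ((N ^^ k) (snd (Q z)))"
        using \<nu> by (simp add: norm_scaleC norm_power)
      also have "\<dots> \<le> ?e * (b ^ k * (K * norm z))"
        using k e \<nu> b K Qz order_trans[OF Nk_le[OF in_Y(4)] mult_left_mono[OF Qz(2)]]
        by (intro mult_mono) auto
      finally show "norm (complex_of_real \<nu> ^ k *\<^sub>C (N ^^ k) (snd (Q z))) \<le> ?e * b ^ k * (K * norm z)"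
        by (simp add: mult.assoc)
    qed
    also have "\<dots> = ?e * (\<Sum>k<d. b ^ k) * (K * norm z)"
      by (simp add: sum_distrib_left sum_distrib_right)
    finally have v: "norm ?v \<le> ?e * (\<Sum>k<d. b ^ k) * (K * norm z)" .
    have "norm (P (R \<nu> z)) \<le> norm ?u + norm ?v"
      using norm_Pair_le[of ?u ?v] by simp
    also have "\<dots> \<le> 2 * ?e * (K * norm z) + ?e * (\<Sum>k<d. b ^ k) * (K * norm z)"
      using u v by (rule add_mono)
    finally have "K * norm (P (R \<nu> z))
        \<le> K * (2 * ?e * (K * norm z) + ?e * (\<Sum>k<d. b ^ k) * (K * norm z))"
      using K by (intro mult_left_mono) auto
    also have "\<dots> = C * ?e * norm z" by (simp add: C_def algebra_simps)
    finally show "norm (R \<nu> z) \<le> C * \<bar>\<nu>\<bar> powi (int d - 1) * norm z"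
      using P_ge[of "R \<nu> z"] \<nu> by simp
  qed
  moreover have "complex_of_real ` {\<omega><..} \<subseteq> resolvent_set E A"
    using a by (auto simp: \<omega>_def intro!: resolvent_set_mem)
  ultimately show "\<exists>\<omega>. \<exists>C>0. complex_of_real ` {\<omega><..} \<subseteq> resolvent_set E A \<and>
      (\<forall>\<mu>>\<omega>. onorm (R \<mu>) \<le> C * \<bar>\<mu>\<bar> powi (int d - 1))"
    using Cpos by blast
next
  fix p
  assume "\<exists>\<omega>. \<exists>C>0. complex_of_real ` {\<omega><..} \<subseteq> resolvent_set E A \<and>
      (\<forall>\<mu>>\<omega>. onorm (R \<mu>) \<le> C * \<bar>\<mu>\<bar> powi (int p - 1))"
  then obtain \<omega> C where C: "C > 0"
    and bound: "\<And>\<mu>. \<mu> > \<omega> \<Longrightarrow> onorm (R \<mu>) \<le> C * \<bar>\<mu>\<bar> powi (int p - 1)" by blast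
  show "d \<le> p"
  proof (rule ccontr)
    assume "\<not> d \<le> p"
    \<comment> \<open>With \<open>d = Suc n\<close> the top power \<open>N ^^ n\<close> is nonzero
      on some \<open>g\<close>, which is fed into the resolvent through \<open>Q\<close>.\<close>
    then obtain n where n: "d = Suc n" and pn: "p \<le> n" by (cases d) auto
    obtain g where g: "g \<in> Y2" "(N ^^ n) g \<noteq> 0" using less_d[of n] n by auto
    obtain z where z: "Q z = (0, g)"
      using Q_surj[of "(0, g)"] g(1) Y1 by (auto simp: complex_vector.subspace_0)
    define c M where "c = norm ((N ^^ n) g)"
      and "M = K * C * norm z + (\<Sum>k<n. b ^ k * norm g)"
    have "c > 0" using g by (simp add: c_def)
    moreover have "c * \<nu> \<le> M" if "\<nu> > max (max a \<omega>) 1" for \<nu>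
    proof -
      have \<nu>: "\<nu> > a" "\<nu> > \<omega>" "\<nu> > 1" using that by auto
      \<comment> \<open>Both the assumed resolvent bound and the lower Neumann terms are at most
        constant multiples of \<open>?e\<close>, while the leading term is
        \<open>?e * (c * \<nu>)\<close>. Cancelling \<open>?e\<close> bounds
        \<open>c * \<nu>\<close> by \<open>M\<close>. For \<open>n = 0\<close> the exponent is
        \<open>-1\<close>.\<close>
      let ?e = "\<nu> powi (int n - 1)" and ?v = "snd (P (R \<nu> z))"
      have epos: "?e > 0" using \<nu> by simp
      have "complex_of_real \<nu> *\<^sub>C N ?v - ?v = g"
        using Q_pencil(2)[of "complex_of_real \<nu>" "R \<nu> z"] \<nu>(1) by (simp add: pencil_R z)
      from neumann_sum[OF in_Y(2) g(1) this]
      have "?v = - ((\<Sum>k<n. complex_of_real \<nu> ^ k *\<^sub>C (N ^^ k) g)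
          + complex_of_real \<nu> ^ n *\<^sub>C (N ^^ n) g)"
        by (simp only: n sum.lessThan_Suc)
      then have "complex_of_real \<nu> ^ n *\<^sub>C (N ^^ n) g
          = - ?v - (\<Sum>k<n. complex_of_real \<nu> ^ k *\<^sub>C (N ^^ k) g)"
        by simp
      then have "norm (complex_of_real \<nu> ^ n *\<^sub>C (N ^^ n) g)
          \<le> norm ?v + norm (\<Sum>k<n. complex_of_real \<nu> ^ k *\<^sub>C (N ^^ k) g)"
        using norm_triangle_ineq4[of "- ?v"] by simp
      also have "norm ?v \<le> ?e * (K * C * norm z)"
      proof -
        have "norm ?v \<le> norm (P (R \<nu> z))" by (rule norm_snd_le_norm)
        also have "\<dots> \<le> K * norm (R \<nu> z)" by (rule P_le)
        also have "\<dots> \<le> K * (onorm (R \<nu>) * norm z)"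
          using K onorm[OF clinear_bounded_linear[OF fdz clinear_R[OF \<nu>(1)]]]
          by (intro mult_left_mono) auto
        also have "\<dots> \<le> K * (C * ?e * norm z)"
        proof (intro mult_left_mono mult_right_mono)
          have "\<bar>\<nu>\<bar> powi (int p - 1) \<le> ?e"
            using \<nu> pn by (auto intro: power_int_increasing)
          then show "onorm (R \<nu>) \<le> C * ?e"
            using bound[OF \<nu>(2)] C by (meson mult_left_mono less_imp_le order_trans)
        qed (use K in auto)
        finally show ?thesis by (simp add: algebra_simps)
      qed
      also have "norm (\<Sum>k<n. complex_of_real \<nu> ^ k *\<^sub>C (N ^^ k) g) \<le> (\<Sum>k<n. ?e * (b ^ k * norm g))"
      proof (rule sum_norm_le)
        fix k assume "k \<in> {..<n}"
        then have "\<nu> ^ k \<le> ?e" using power_int_increasing[of "int k" "int n - 1" \<nu>] \<nu> by simp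
        then show "norm (complex_of_real \<nu> ^ k *\<^sub>C (N ^^ k) g) \<le> ?e * (b ^ k * norm g)"
          using \<nu> Nk_le[OF g(1), of k] by (auto simp: norm_scaleC norm_power intro!: mult_mono)
      qed
      also have "norm (complex_of_real \<nu> ^ n *\<^sub>C (N ^^ n) g) = ?e * (c * \<nu>)"
      proof -
        have "\<nu> ^ n = ?e * \<nu>" using \<nu> power_int_minus_mult[of \<nu> "int n"] by simp
        then show ?thesis using \<nu> by (simp add: norm_scaleC norm_power c_def)
      qed
      also have "?e * (K * C * norm z) + (\<Sum>k<n. ?e * (b ^ k * norm g)) = ?e * M"
        by (simp add: M_def distrib_left sum_distrib_left)
      finally show ?thesis using epos by simp
    qed
    ultimately show False by (rule linear_bounded_above_imp_False)
  qed
qed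

end

section \<open>Constants for a given Weierstrass form, and the conclusion\<close>

text \<open>The ranges of \<open>P\<close> and \<open>Q\<close> are only subspaces of
  \<open>'x \<times> 'x\<close>. A left inverse defined on the whole product is bounded and yields
  the estimates from below.\<close>

lemma clinear_left_inverse:
  fixes f :: "'a::complex_vector \<Rightarrow> 'b::complex_vector"
  assumes "clinear f" "inj f"
  obtains g where "clinear g" "\<And>x. g (f x) = x"
proof -
  have "vector_space_pair (scaleC :: complex \<Rightarrow> 'a \<Rightarrow> 'a) (scaleC :: complex \<Rightarrow> 'b \<Rightarrow> 'b)"
    by unfold_locales
  from vector_space_pair.linear_injective_left_inverse[OF this assms]
  obtain g where "clinear g" "g \<circ> f = id" by blast
  then show ?thesis using that by (metis comp_apply id_apply)
qed

lemma clinear_norm_le: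
  fixes f :: "'a::complex_hilbert \<Rightarrow> 'b::complex_hilbert"
  assumes "finite_dim TYPE('a)" "clinear f"
  obtains K where "K > 0" "\<And>x. norm (f x) \<le> K * norm x"
  using bounded_linear.pos_bounded[OF clinear_bounded_linear[OF assms]] by (metis mult.commute)

lemma weierstrass_form_bounded:
  fixes E A :: "'x::complex_hilbert \<Rightarrow> 'z::complex_hilbert"
  assumes fd: "finite_dim TYPE('x)" "finite_dim TYPE('z)" and E: "clinear E" and A: "clinear A"
    and \<mu>: "\<mu> \<in> resolvent_set E A" and wf: "weierstrass_form E A Y1 Y2 A1 N"
  obtains P Q a b K where "bounded_weierstrass_form E A Y1 Y2 A1 N P Q a b K \<mu>"
proof -
  have sub: "csubspace Y1" "csubspace Y2" and endo: "linear_endo_on Y1 A1" "linear_endo_on Y2 N"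
    and bN: "bounded_on Y2 N" and nilp: "\<exists>p. \<forall>y\<in>Y2. (N ^^ p) y = 0"
    using wf by (auto simp: weierstrass_form_def)
  obtain P Q where P: "clinear P" "bij_betw P UNIV (Y1 \<times> Y2)"
    and Q: "clinear Q" "bij_betw Q UNIV (Y1 \<times> Y2)"
    and EQ: "E = inv Q \<circ> (\<lambda>(u, v). (u, N v)) \<circ> P" and AQ: "A = inv Q \<circ> (\<lambda>(u, v). (A1 u, v)) \<circ> P"
    using wf unfolding weierstrass_form_def equivalent_pairs_def by (elim conjE exE) (rule that)
  have inj: "inj P" "inj Q" and ran: "range P = Y1 \<times> Y2" "range Q = Y1 \<times> Y2"
    using P Q by (simp_all add: bij_betw_def)
  have Pin: "P x \<in> Y1 \<times> Y2" for x using ran by blast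
  have QE: "Q (E x) = (fst (P x), N (snd (P x)))" for x
  proof -
    have "(fst (P x), N (snd (P x))) \<in> range Q"
      using Pin[of x] endo by (auto simp: ran linear_endo_on_def)
    then show ?thesis by (simp add: EQ case_prod_unfold f_inv_into_f)
  qed
  have QA: "Q (A x) = (A1 (fst (P x)), snd (P x))" for x
  proof -
    have "(A1 (fst (P x)), snd (P x)) \<in> range Q"
      using Pin[of x] endo by (auto simp: ran linear_endo_on_def)
    then show ?thesis by (simp add: AQ case_prod_unfold f_inv_into_f)
  qed
  note fd2 = finite_dim_prod[OF fd(1) fd(1)]
  obtain G where G: "clinear G" "\<And>x. G (P x) = x" using clinear_left_inverse[OF P(1) inj(1)] by blast
  obtain H where H: "clinear H" "\<And>z. H (Q z) = z" using clinear_left_inverse[OF Q(1) inj(2)] by blast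
  obtain K1 where K1: "K1 > 0" "\<And>x. norm (P x) \<le> K1 * norm x"
    using clinear_norm_le[OF fd(1) P(1)] by blast
  obtain K2 where K2: "K2 > 0" "\<And>x. norm (Q x) \<le> K2 * norm x"
    using clinear_norm_le[OF fd(2) Q(1)] by blast
  obtain K3 where K3: "K3 > 0" "\<And>x. norm (G x) \<le> K3 * norm x"
    using clinear_norm_le[OF fd2 G(1)] by blast
  obtain K4 where K4: "K4 > 0" "\<And>x. norm (H x) \<le> K4 * norm x"
    using clinear_norm_le[OF fd2 H(1)] by blast
  define K where "K = K1 + K2 + K3 + K4"
  have K: "K > 0" "K1 \<le> K" "K2 \<le> K" "K3 \<le> K" "K4 \<le> K"
    using K1(1) K2(1) K3(1) K4(1) by (simp_all add: K_def)
  \<comment> \<open>\<open>A1\<close> is linear only on \<open>Y1\<close> and arbitrary outside.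
    \<open>A'\<close> agrees with it on \<open>Y1\<close> and is linear everywhere, hence
    bounded.\<close>
  define A' where "A' u = fst (Q (A (G (u, 0))))" for u
  have "clinear A'"
  proof (rule clinearI)
    fix u v :: 'x and c
    have "(u + v, 0) = (u, 0) + (v, 0::'x)" by simp
    then show "A' (u + v) = A' u + A' v"
      unfolding A'_def by (simp only: clinear_add[OF G(1)] clinear_add[OF A] clinear_add[OF Q(1)] fst_add)
    have "(c *\<^sub>C u, 0) = c *\<^sub>C (u, 0::'x)" by (simp add: scaleC_prod_def scaleC_zero_right)
    then show "A' (c *\<^sub>C u) = c *\<^sub>C A' u"
      unfolding A'_def
      by (simp only: clinear_scaleC[OF G(1)] clinear_scaleC[OF A] clinear_scaleC[OF Q(1)])
        (simp add: scaleC_prod_def)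
  qed
  then obtain a where a: "a > 0" "\<And>u. norm (A' u) \<le> a * norm u" using clinear_norm_le[OF fd(1)] by blast
  have A1_le: "norm (A1 u) \<le> a * norm u" if "u \<in> Y1" for u
  proof -
    have "(u, 0) \<in> range P" using that sub by (simp add: ran complex_vector.subspace_0)
    then obtain x where x: "P x = (u, 0)" by (metis imageE)
    then have "A' u = A1 u" using QA[of x] G(2)[of x] by (simp add: A'_def)
    then show ?thesis using a(2)[of u] by simp
  qed
  obtain b where b: "\<And>v. v \<in> Y2 \<Longrightarrow> norm (N v) \<le> b * norm v" using bN unfolding bounded_on_def by blast
  \<comment> \<open>The constant from \<open>bounded_on\<close> may be negative if \<open>Y2\<close>
    is zero, hence the absolute value.\<close>
  have N_le: "norm (N v) \<le> \<bar>b\<bar> * norm v" if "v \<in> Y2" for v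
    using b[OF that] mult_right_mono[OF abs_ge_self[of b] norm_ge_zero[of v]] by linarith
  have "bounded_weierstrass_form E A Y1 Y2 A1 N P Q a \<bar>b\<bar> K \<mu>"
  proof (rule bounded_weierstrass_form.intro)
    show "norm (P x) \<le> K * norm x" for x
      using K1(2)[of x] mult_right_mono[OF K(2) norm_ge_zero[of x]] by linarith
    show "norm (Q z) \<le> K * norm z" for z
      using K2(2)[of z] mult_right_mono[OF K(3) norm_ge_zero[of z]] by linarith
    show "norm x \<le> K * norm (P x)" for x
      using K3(2)[of "P x"] mult_right_mono[OF K(4) norm_ge_zero[of "P x"]] G(2)[of x] by simp
    show "norm z \<le> K * norm (Q z)" for z
      using K4(2)[of "Q z"] mult_right_mono[OF K(5) norm_ge_zero[of "Q z"]] H(2)[of z] by simp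
    show "\<exists>x. P x = w" if "w \<in> Y1 \<times> Y2" for w using that ran(1) by (metis imageE)
    show "\<exists>z. Q z = w" if "w \<in> Y1 \<times> Y2" for w using that ran(2) by (metis imageE)
    show "Q z \<in> Y1 \<times> Y2" for z using ran(2) by blast
  qed (fact fd E A sub endo nilp P(1) Q(1) Pin QE QA K(1) less_imp_le[OF a(1)] A1_le abs_ge_zero N_le \<mu>)+
  then show ?thesis by (rule that)
qed

text \<open>Degree 0 forces \<open>Y2\<close> to be zero. The middle map of the form then fixes the
  range of \<open>P\<close>, and \<open>E\<close> is \<open>inv Q \<circ> P\<close>.\<close>

lemma weierstrass_form_degree_0_imp_bij:
  assumes wf: "weierstrass_form E A Y1 Y2 A1 N" and "nilpotency_degree Y2 N = 0"
  shows "bij E"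
proof -
  obtain p where "\<forall>y\<in>Y2. (N ^^ p) y = 0" using wf unfolding weierstrass_form_def by blast
  then have "\<forall>y\<in>Y2. (N ^^ nilpotency_degree Y2 N) y = 0"
    unfolding nilpotency_degree_def by (rule LeastI)
  then have Y2: "y = 0" if "y \<in> Y2" for y using that assms(2) by simp
  have N_in: "\<forall>v\<in>Y2. N v \<in> Y2" using wf by (simp add: weierstrass_form_def linear_endo_on_def)
  obtain P Q where P: "bij_betw P UNIV (Y1 \<times> Y2)" and Q: "bij_betw Q UNIV (Y1 \<times> Y2)"
    and EQ: "E = inv Q \<circ> (\<lambda>(u, v). (u, N v)) \<circ> P"
    using wf unfolding weierstrass_form_def equivalent_pairs_def by (elim conjE exE) (rule that)
  have "(case P x of (u, v) \<Rightarrow> (u, N v)) = P x" for x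
  proof -
    have "P x \<in> Y1 \<times> Y2" using P by (auto simp: bij_betw_def)
    then obtain u v where "P x = (u, v)" "v \<in> Y2" by blast
    then show ?thesis using Y2[of v] Y2[of "N v"] N_in by simp
  qed
  then have "E = inv Q \<circ> P" by (simp add: EQ fun_eq_iff)
  then show ?thesis using bij_betw_trans[OF P bij_betw_inv_into[OF Q]] by simp
qed

text \<open>If \<open>E\<close> is bijective, the nilpotent block is absent and
  \<open>nilp_index\<close> and \<open>res_index\<close> are 0, whereas
  \<open>rad_index E A + 1\<close> is at least 1. The equalities with the radiality index are
  therefore stated for \<open>E\<close> that is not bijective.\<close>

theorem proposition6p9:
  fixes E A :: "'x::complex_hilbert \<Rightarrow> 'z::complex_hilbert"
  assumes "finite_dim TYPE('x)" and "finite_dim TYPE('z)"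
    and "bounded_clinear E" and "clinear A"
    and "resolvent_set E A \<noteq> {}"
  shows "nilp_index E A = res_index E A \<and>
    (\<not> bij E \<longrightarrow> nilp_index E A = rad_index E A + 1 \<and> rad_index E A + 1 = res_index E A)"
proof -
  have E: "clinear E" using assms(3) by (simp add: bounded_clinear_def)
  obtain \<mu> where \<mu>: "\<mu> \<in> resolvent_set E A" using assms(5) by blast
  \<comment> \<open>Every Weierstrass form has the same degree, because \<open>res_index\<close>
    does not refer to the form; this makes the \<open>THE\<close> in \<open>nilp_index\<close> well
    defined.\<close>
  have degree: "nilpotency_degree Y2 N = res_index E A"
    "\<not> bij E \<Longrightarrow> nilpotency_degree Y2 N = rad_index E A + 1"
    if wf: "weierstrass_form E A Y1 Y2 A1 N" for Y1 Y2 A1 N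
  proof -
    obtain P Q a b K where "bounded_weierstrass_form E A Y1 Y2 A1 N P Q a b K \<mu>"
      using weierstrass_form_bounded[OF assms(1,2) E assms(4) \<mu> wf] by blast
    then interpret bounded_weierstrass_form E A Y1 Y2 A1 N P Q a b K \<mu> .
    show "nilpotency_degree Y2 N = res_index E A" by (rule res_index_eq[symmetric])
    assume "\<not> bij E"
    then have "nilpotency_degree Y2 N > 0" using weierstrass_form_degree_0_imp_bij[OF wf] by auto
    then show "nilpotency_degree Y2 N = rad_index E A + 1" using rad_index_eq by simp
  qed
  obtain Y1 Y2 A1 N where wf: "weierstrass_form E A Y1 Y2 A1 N"
    using weierstrass_form_exists[OF assms(1) E assms(4) \<mu>] by blast
  have "nilp_index E A = res_index E A"
    unfolding nilp_index_def
  proof (rule the_equality)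
    show "\<exists>Y1 Y2 A1 N. weierstrass_form E A Y1 Y2 A1 N \<and> res_index E A = nilpotency_degree Y2 N"
      using wf degree(1)[OF wf] by metis
  qed (use degree(1) in blast)
  then show ?thesis using degree[OF wf] by simp
qed

end
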